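(* Let $n\ge 2$ and let $p\in\operatorname{int}\mathcal P_{2n-1}$ be a positive polynomial with zeros $\zeta_1,\dots,\zeta_{n-1}$ (counted with multiplicity) in the open upper half-plane. Then there is a unique $c=(c_0,\dots,c_{2n-2})\in\operatorname{int}\mathcal M_{2n-1}$ such that $p=N(c)$. Consider the equilibrium conditions $$(\mathrm{E}_{n})\qquad \sum_{\substack{j=1\\ j\neq k}}^{n}\frac{2}{x_k-x_j}-\sum_{j=1}^{n-1}\left(\frac{1}{x_k-\zeta_j}+\frac{1}{x_k-\overline{\zeta}_j}\right)=0,\qquad k=1,\dots,n,$$ $$(\mathrm{E}_{n-1})\qquad \sum_{\substack{j=1\\ j\neq k}}^{n-1}\frac{2}{t_k-t_j}-\sum_{j=1}^{n-1}\left(\frac{1}{t_k-\zeta_j}+\frac{1}{t_k-\overline{\zeta}_j}\right)=0,\qquad k=1,\dots,n-1,$$ for real numbers $x_1,\dots,x_n$ and $t_1,\dots,t_{n-1}$, respectively, and the canonical representations $$(\mathrm{C}_{n-1})\qquad c_k=\sum_{j=1}^{n-1}\sigma_j t_j^k\quad(k=0,\dots,2n-3),\qquad c_{2n-2}=\sum_{j=1}^{n-1}\sigma_j t_j^{2n-2}+\lambda,$$ $$(\mathrm{C}_{n})\qquad c_k=\sum_{j=1}^{n}\varrho_j x_j^k,\qquad k=0,\dots,2n-2.$$ If $x_1,\dots,x_n$ and $t_1,\dots,t_{n-1}$ satisfy $(\mathrm{E}_n)$ and $(\mathrm{E}_{n-1})$, respectively, then the canonical representations $(\mathrm{C}_{n-1})$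 and $(\mathrm{C}_n)$ hold with the positive numbers $$(\ast)\qquad \sigma_k=\frac1{p(t_k)}\ (k=1,\dots,n-1),\qquad \varrho_k=\frac1{p(x_k)}\ (k=1,\dots,n),\qquad \lambda=\frac1{p_{2n-2}},$$ where $p_{2n-2}$ is the leading coefficient of $p$. Conversely, if $(\mathrm{C}_{n-1})$ and $(\mathrm{C}_n)$ are satisfied for real numbers $x_1,\dots,x_n$, $t_1,\dots,t_{n-1}$ and positive numbers $\sigma_k,\varrho_k,\lambda$, then the equilibrium conditions $(\mathrm{E}_n)$ and $(\mathrm{E}_{n-1})$ also hold; moreover, $\sigma_k$, $\varrho_k$ and $\lambda$ satisfy $(\ast)$.
   Context: Interiors are taken in $\mathbb R^{2n-1}$. Vectors $(p_0,\dots,p_{2n-2})\in\mathbb R^{2n-1}$ are identified with polynomials $p(x)=p_0+p_1x+\dots+p_{2n-2}x^{2n-2}$. $\mathcal P_{2n-1}\subset\mathbb R^{2n-1}$ is the convex cone of (coefficient vectors of) real polynomials of degree at most $2n-2$ that are non-negative on $\mathbb R$. An interior point $p$ has $p_{2n-2}>0$ and no real zeros, so it has exactly $n-1$ zeros (with multiplicity) in the open upper half-plane, the other zeros being their complex conjugates. $\mathcal M_{2n-1}\subset\mathbb R^{2n-1}$ is the moment cone of all $c=(c_0,\dots,c_{2n-2})$ with $c_k=\int_{-\infty}^{\infty}t^k\,d\sigma$ ($k=0,\dots,2n-2$) for some nonnegative measure $\sigma$ on $\mathbb R$ with $\int|t|^k\,d\sigma<\infty$ for $k=0,\dots,2n-2$.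 For $c\in\mathbb R^{2n-1}$, $H(c)=(c_{i+j})_{i,j=0}^{n-1}\in\mathbb R^{n\times n}$ is the associated Hankel matrix. It is a standard fact that $c\in\operatorname{int}\mathcal M_{2n-1}$ if and only if $H(c)$ is positive definite. The map $H^*:\mathbb R^{n\times n}\to\mathbb R^{2n-1}$ sends $X=(x_{ij})_{i,j=0}^{n-1}$ to the vector $y=(y_0,\dots,y_{2n-2})$ of its anti-diagonal sums, $y_k=\sum_{i+j=k}x_{ij}$. The Nesterov mapping is $N(c):=H^*\big(H(c)^{-1}\big)$, defined whenever $H(c)$ is nonsingular. Saying that points satisfy $(\mathrm{E}_n)$ or $(\mathrm{E}_{n-1})$ includes that they are pairwise distinct real numbers, so that the expressions are defined. Empty sums are $0$. *)

theory Defs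
  imports
    "HOL-Analysis.Analysis"
    "HOL-Computational_Algebra.Fundamental_Theorem_Algebra"
    "Jordan_Normal_Form.Gauss_Jordan_Elimination"
begin

text \<open>
  Vectors in \<open>\<real>\<^sup>d\<close> are the points of the topology \<^const>\<open>Euclidean_space\<close> \<open>d\<close>, i.e. functions
  \<^typ>\<open>nat \<Rightarrow> real\<close> that vanish at all indices \<open>\<ge> d\<close>. In this encoding the coefficient vector of a
  polynomial of degree at most \<open>2n - 2\<close> is its coefficient function, a point of \<open>\<real>\<^bsup>2n-1\<^esup>\<close>.
\<close>

definition nonneg_cone :: "nat \<Rightarrow> (nat \<Rightarrow> real) set" where
  "nonneg_cone n = {coeff q | q. degree q \<le> 2 * n - 2 \<and> (\<forall>x::real. 0 \<le> poly q x)}"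

definition moment_cone :: "nat \<Rightarrow> (nat \<Rightarrow> real) set" where
  "moment_cone n = {c \<in> topspace (Euclidean_space (2 * n - 1)).
     \<exists>M::real measure. sets M = sets borel \<and>
       (\<forall>k\<le>2 * n - 2. integrable M (\<lambda>t. \<bar>t\<bar> ^ k) \<and> c k = (LINT t|M. t ^ k))}"

definition int_nonneg_cone :: "nat \<Rightarrow> (nat \<Rightarrow> real) set" where
  "int_nonneg_cone n = Euclidean_space (2 * n - 1) interior_of nonneg_cone n"

definition int_moment_cone :: "nat \<Rightarrow> (nat \<Rightarrow> real) set" where
  "int_moment_cone n = Euclidean_space (2 * n - 1) interior_of moment_cone n"

definition hankel :: "nat \<Rightarrow> (nat \<Rightarrow> real) \<Rightarrow> real mat" where
  "hankel n c = mat n n (\<lambda>(i, j). c (i + j))"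

definition antidiag_sums :: "real mat \<Rightarrow> nat \<Rightarrow> real" where
  "antidiag_sums X k =
     (\<Sum>(i, j) | i < dim_row X \<and> j < dim_col X \<and> i + j = k. X $$ (i, j))"

text \<open>
  The Nesterov mapping is partial: its value is \<^const>\<open>None\<close> exactly when the Hankel matrix is
  singular.
\<close>

definition nesterov :: "nat \<Rightarrow> (nat \<Rightarrow> real) \<Rightarrow> (nat \<Rightarrow> real) option" where
  "nesterov n c = map_option antidiag_sums (mat_inverse (hankel n c))"

text \<open>
  The list \<open>\<zeta> 1, \<dots>, \<zeta> m\<close> enumerates, with multiplicity, the zeros of \<open>p\<close> in the open upper
  half-plane.
\<close>

definition upper_zeros :: "real poly \<Rightarrow> nat \<Rightarrow> (nat \<Rightarrow> complex) \<Rightarrow> bool" where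
  "upper_zeros p m \<zeta> \<longleftrightarrow>
     image_mset \<zeta> (mset_set {1..m}) =
     filter_mset (\<lambda>z. Im z > 0) (proots (map_poly complex_of_real p))"

text \<open>
  Equilibrium of \<open>m\<close> distinct real points \<open>x 1, \<dots>, x m\<close> in the presence of the \<open>l\<close> conjugate pairs
  \<open>\<zeta> j, cnj (\<zeta> j)\<close>.
\<close>

definition equilibrium :: "nat \<Rightarrow> nat \<Rightarrow> (nat \<Rightarrow> complex) \<Rightarrow> (nat \<Rightarrow> real) \<Rightarrow> bool" where
  "equilibrium m l \<zeta> x \<longleftrightarrow> inj_on x {1..m} \<and>
     (\<forall>k\<in>{1..m}.
        (\<Sum>j\<in>{1..m} - {k}. 2 / (complex_of_real (x k) - complex_of_real (x j)))
        - (\<Sum>j=1..l. 1 / (complex_of_real (x k) - \<zeta> j)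
                    + 1 / (complex_of_real (x k) - cnj (\<zeta> j))) = 0)"

definition canonical_rep ::
    "nat \<Rightarrow> (nat \<Rightarrow> real) \<Rightarrow> (nat \<Rightarrow> real) \<Rightarrow> (nat \<Rightarrow> real) \<Rightarrow> bool" where
  "canonical_rep n c x \<rho> \<longleftrightarrow> (\<forall>k\<le>2 * n - 2. c k = (\<Sum>j=1..n. \<rho> j * x j ^ k))"

text \<open>The canonical representation with \<open>n - 1\<close> real nodes and a mass \<open>l\<close> at infinity.\<close>

definition canonical_rep_inf ::
    "nat \<Rightarrow> (nat \<Rightarrow> real) \<Rightarrow> (nat \<Rightarrow> real) \<Rightarrow> (nat \<Rightarrow> real) \<Rightarrow> real \<Rightarrow> bool" where
  "canonical_rep_inf n c t \<sigma> l \<longleftrightarrow>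
     (\<forall>k\<le>2 * n - 3. c k = (\<Sum>j=1..n-1. \<sigma> j * t j ^ k)) \<and>
     c (2 * n - 2) = (\<Sum>j=1..n-1. \<sigma> j * t j ^ (2 * n - 2)) + l"

end

theory Submission
  imports Defs "Jordan_Normal_Form.Determinant"
begin

text \<open>
  A representation \<open>(C\<^sub>n)\<close> turns the Hankel form into \<open>\<Sum>\<^sub>k \<rho>\<^sub>k f(x\<^sub>k) g(x\<^sub>k)\<close>, for which the Lagrange
  polynomials \<open>L\<^sub>k\<close> of the nodes are an orthogonal basis, so that \<open>N(c) = \<Sum>\<^sub>k L\<^sub>k\<^sup>2 / \<rho>\<^sub>k\<close>. This polynomial
  has value \<open>1 / \<rho>\<^sub>k\<close> and logarithmic derivative \<open>\<Sum>\<^sub>j 2 / (x\<^sub>k - x\<^sub>j)\<close> at \<open>x\<^sub>k\<close>. Hence \<open>N(c) = p\<close> forces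
  the equilibrium conditions and the weights \<open>1 / p(x\<^sub>k)\<close>; conversely these conditions make \<open>p\<close> and
  \<open>N(c)\<close> agree to second order at all nodes, so they coincide. For \<open>(C\<^sub>n\<^sub>-\<^sub>1)\<close> one adds the basis element
  \<open>\<omega> = \<Prod>\<^sub>j (x - t\<^sub>j)\<close>, which carries the mass at infinity. Existence of \<open>c\<close> reduces to existence of an
  equilibrium of \<open>n - 1\<close> points, a maximiser of \<open>\<Prod>\<^sub>i\<^sub><\<^sub>j (t\<^sub>i - t\<^sub>j)\<^sup>2 / \<Prod>\<^sub>i p(t\<^sub>i)\<close>. Uniqueness follows
  by comparing the quadratures of two solutions, since a weighted sum of squares of the differences
  of their mixed moments telescopes to \<open>n - 2n + n = 0\<close>.
\<close>

hide_const (open) Module.smult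

section \<open>Real-rooted polynomials and Lagrange interpolation\<close>

text \<open>The field is left general because the same product serves for the real nodes and for the
  complex zeros of \<open>p\<close>.\<close>

definition root_poly :: "('i \<Rightarrow> 'a::field) \<Rightarrow> 'i set \<Rightarrow> 'a poly" where
  "root_poly x A = (\<Prod>j\<in>A. [:- x j, 1:])"

lemma poly_root_poly: "poly (root_poly x A) z = (\<Prod>j\<in>A. z - x j)"
  by (simp add: root_poly_def poly_prod)

lemma root_poly_nonzero [simp]: "root_poly x A \<noteq> 0"
  unfolding root_poly_def by (cases "finite A") auto

lemma degree_root_poly: "degree (root_poly x A) = card A"
  unfolding root_poly_def
  by (cases "finite A") (auto simp: degree_prod_sum_eq)

lemma monic_root_poly: "coeff (root_poly x A) (card A) = 1"
proof -
  have "lead_coeff (root_poly x A) = 1"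
    unfolding root_poly_def by (simp add: lead_coeff_prod)
  then show ?thesis by (simp add: degree_root_poly)
qed

lemma poly_root_poly_eq_0_iff:
  "finite A \<Longrightarrow> poly (root_poly x A) z = 0 \<longleftrightarrow> z \<in> x ` A"
  by (auto simp: poly_root_poly)

lemma logderiv_root_poly:
  assumes "finite A" "z \<notin> x ` A"
  shows "poly (pderiv (root_poly x A)) z = poly (root_poly x A) z * (\<Sum>j\<in>A. 1 / (z - x j))"
  using assms
proof (induction A rule: finite_induct)
  case (insert a A)
  define R where "R = root_poly x A"
  have *: "root_poly x (insert a A) = [:- x a, 1:] * R"
    using insert by (simp add: root_poly_def R_def)
  have "z - x a \<noteq> 0" using insert.prems by auto
  moreover have "poly (pderiv R) z = poly R z * (\<Sum>j\<in>A. 1 / (z - x j))"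
    using insert by (simp add: R_def)
  ultimately show ?case
    using insert.hyps unfolding * pderiv_mult
    by (simp add: pderiv_pCons field_simps del: mult_pCons_left)
qed (simp add: root_poly_def)

text \<open>Every \<open>x k\<close> is a root of order at least 2, so a nonzero \<open>r\<close>
  would have at least \<open>2 * card A\<close> roots with multiplicity. This is uniqueness in
  Hermite interpolation, which later identifies \<open>p\<close> with a kernel.\<close>

lemma poly_eq_0_double_roots:
  fixes r :: "real poly"
  assumes "finite A" "inj_on x A" "degree r < 2 * card A"
    and "\<And>k. k \<in> A \<Longrightarrow> poly r (x k) = 0" "\<And>k. k \<in> A \<Longrightarrow> poly (pderiv r) (x k) = 0"
  shows "r = 0"
proof (rule ccontr)
  assume "r \<noteq> 0"
  have "2 \<le> order (x k) r" if "k \<in> A" for k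
  proof -
    have "poly r (x k) = 0" using assms that by blast
    have "pderiv r \<noteq> 0"
    proof
      assume "pderiv r = 0"
      then have "degree r = 0" by (simp add: pderiv_eq_0_iff)
      then obtain c where "r = [:c:]" by (rule degree_eq_zeroE)
      then show False using \<open>r \<noteq> 0\<close> \<open>poly r (x k) = 0\<close> by simp
    qed
    then have "order (x k) (pderiv r) \<noteq> 0" "order (x k) r = Suc (order (x k) (pderiv r))"
      using assms(5)[OF that] order_root order_pderiv[OF \<open>r \<noteq> 0\<close>, of "x k"] \<open>poly r (x k) = 0\<close>
      by blast+
    then show ?thesis by simp
  qed
  then have "(\<Sum>k\<in>A. 2) \<le> (\<Sum>k\<in>A. count (proots r) (x k))"
    using \<open>r \<noteq> 0\<close> by (intro sum_mono) simp
  also have "\<dots> = (\<Sum>y\<in>x ` A. count (proots r) y)"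
    using assms(2) by (simp add: sum.reindex)
  also have "\<dots> \<le> (\<Sum>y\<in>set_mset (proots r). count (proots r) y)"
    using \<open>r \<noteq> 0\<close> poly_roots_finite[OF \<open>r \<noteq> 0\<close>] assms(4) by (intro sum_mono2) auto
  also have "\<dots> = size (proots r)" by (simp add: size_multiset_overloaded_eq)
  also have "\<dots> \<le> degree r" by (rule size_proots_le)
  finally show False using assms(3) by simp
qed

lemma poly_eq_0_many_roots:
  fixes r :: "real poly"
  assumes "finite A" "inj_on x A" "degree r < card A" "\<And>k. k \<in> A \<Longrightarrow> poly r (x k) = 0"
  shows "r = 0"
proof (rule ccontr)
  assume "r \<noteq> 0"
  have "card (x ` A) \<le> card {z. poly r z = 0}"
    using poly_roots_finite[OF \<open>r \<noteq> 0\<close>] assms(4) by (intro card_mono) auto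
  also have "\<dots> \<le> degree r" using \<open>r \<noteq> 0\<close> by (rule card_poly_roots_bound)
  finally show False using assms by (simp add: card_image)
qed

definition lagrange_poly :: "('i \<Rightarrow> real) \<Rightarrow> 'i set \<Rightarrow> 'i \<Rightarrow> real poly" where
  "lagrange_poly x A k = smult (1 / poly (root_poly x (A - {k})) (x k)) (root_poly x (A - {k}))"

lemma lagrange_poly_denominator:
  assumes "finite A" "inj_on x A" "k \<in> A"
  shows "poly (root_poly x (A - {k})) (x k) \<noteq> 0"
  using assms by (subst poly_root_poly_eq_0_iff) (auto simp: inj_on_def)

lemma poly_lagrange_poly:
  assumes "finite A" "inj_on x A" "k \<in> A" "j \<in> A"
  shows "poly (lagrange_poly x A k) (x j) = (if j = k then 1 else 0)"
  using lagrange_poly_denominator[OF assms(1-3)] assms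
    poly_root_poly_eq_0_iff[of "A - {k}" x "x j"]
  by (auto simp: lagrange_poly_def)

lemma degree_lagrange_poly:
  assumes "finite A" "k \<in> A"
  shows "degree (lagrange_poly x A k) < card A"
proof -
  have "degree (lagrange_poly x A k) \<le> card (A - {k})"
    unfolding lagrange_poly_def by (metis degree_smult_le degree_root_poly)
  moreover have "card (A - {k}) < card A"
    using assms by (intro psubset_card_mono) auto
  ultimately show ?thesis by simp
qed

lemma lagrange_interpolation:
  assumes "finite A" "inj_on x A" "degree f < card A"
  shows "(\<Sum>k\<in>A. smult (poly f (x k)) (lagrange_poly x A k)) = f"
proof -
  let ?g = "\<Sum>k\<in>A. smult (poly f (x k)) (lagrange_poly x A k)"
  have "degree ?g \<le> card A - 1"
  proof (rule degree_sum_le[OF assms(1)])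
    fix k assume "k \<in> A"
    then show "degree (smult (poly f (x k)) (lagrange_poly x A k)) \<le> card A - 1"
      using degree_lagrange_poly[OF assms(1) \<open>k \<in> A\<close>, of x]
        degree_smult_le[of "poly f (x k)" "lagrange_poly x A k"] by simp
  qed
  then have "degree (?g - f) < card A"
    using assms(3) by (intro degree_diff_less) auto
  moreover have "poly (?g - f) (x j) = 0" if "j \<in> A" for j
    using assms that by (simp add: poly_sum poly_lagrange_poly if_distrib cong: if_cong)
  ultimately have "?g - f = 0" using poly_eq_0_many_roots assms by blast
  then show ?thesis by simp
qed

text \<open>Since \<open>lagrange_poly x A k\<close> has value 1 at \<open>x k\<close>, its
  derivative there is the logarithmic derivative of the nodal polynomial of the other nodes.\<close>

lemma deriv_lagrange_poly:
  assumes "finite A" "inj_on x A" "k \<in> A"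
  shows "poly (pderiv (lagrange_poly x A k)) (x k) = (\<Sum>j\<in>A - {k}. 1 / (x k - x j))"
proof -
  have "x k \<notin> x ` (A - {k})" using assms by (auto simp: inj_on_def)
  then show ?thesis using assms lagrange_poly_denominator[OF assms]
    by (simp add: lagrange_poly_def pderiv_smult logderiv_root_poly)
qed

text \<open>For \<open>j \<noteq> k\<close> the square of \<open>lagrange_poly x A j\<close> has a
  double zero at \<open>x k\<close>, so only the \<open>k\<close>-th summand contributes to value
  and derivative.\<close>

lemma deriv_lagrange_kernel:
  assumes "finite A" "inj_on x A" "k \<in> A"
  shows "poly (\<Sum>j\<in>A. smult (w j) ((lagrange_poly x A j)\<^sup>2)) (x k) = w k"
    and "poly (pderiv (\<Sum>j\<in>A. smult (w j) ((lagrange_poly x A j)\<^sup>2))) (x k)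
      = 2 * w k * (\<Sum>j\<in>A - {k}. 1 / (x k - x j))"
proof -
  show "poly (\<Sum>j\<in>A. smult (w j) ((lagrange_poly x A j)\<^sup>2)) (x k) = w k"
    using assms by (simp add: poly_sum poly_lagrange_poly if_distrib if_distribR cong: if_cong)
  have "poly (pderiv (\<Sum>j\<in>A. smult (w j) ((lagrange_poly x A j)\<^sup>2))) (x k)
    = (\<Sum>j\<in>A. if j = k then 2 * w k * (\<Sum>j\<in>A - {k}. 1 / (x k - x j)) else 0)"
    unfolding higher_pderiv_sum[where n = 1, simplified] poly_sum
    using assms by (intro sum.cong)
      (auto simp: pderiv_smult pderiv_mult power2_eq_square poly_lagrange_poly deriv_lagrange_poly)
  then show "poly (pderiv (\<Sum>j\<in>A. smult (w j) ((lagrange_poly x A j)\<^sup>2))) (x k)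
      = 2 * w k * (\<Sum>j\<in>A - {k}. 1 / (x k - x j))"
    using assms by simp
qed

section \<open>Moment functionals and the Nesterov mapping\<close>

text \<open>The linear functional that sends \<open>x ^ k\<close> to \<open>c k\<close>. It is
  defined on all polynomials at once; \<open>mom_altdef\<close> permits any larger summation
  bound.\<close>

definition mom :: "(nat \<Rightarrow> real) \<Rightarrow> real poly \<Rightarrow> real" where
  "mom c f = (\<Sum>i\<le>degree f. coeff f i * c i)"

lemma mom_altdef: "degree f \<le> N \<Longrightarrow> mom c f = (\<Sum>i\<le>N. coeff f i * c i)"
  unfolding mom_def by (intro sum.mono_neutral_left) (auto simp: coeff_eq_0)

lemma mom_add: "mom c (f + g) = mom c f + mom c g"
proof -
  define N where "N = max (degree f) (degree g)"
  have "degree (f + g) \<le> N" "degree f \<le> N" "degree g \<le> N"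
    by (auto simp: N_def degree_add_le_max)
  then show ?thesis by (simp add: mom_altdef sum.distrib algebra_simps)
qed

lemma mom_0 [simp]: "mom c 0 = 0"
  by (simp add: mom_def)

lemma mom_smult: "mom c (smult a f) = a * mom c f"
  using mom_altdef[of "smult a f" "degree f" c] by (simp add: mom_def sum_distrib_left mult_ac)

lemma mom_diff: "mom c (f - g) = mom c f - mom c g"
  using mom_add[of c f "- g"] mom_smult[of c "- 1" g] by simp

lemma mom_sum: "mom c (\<Sum>a\<in>A. f a) = (\<Sum>a\<in>A. mom c (f a))"
  by (induction A rule: infinite_finite_induct) (auto simp: mom_add)

lemma mom_monom: "mom c (monom a k) = a * c k"
proof -
  have "mom c (monom a k) = (\<Sum>i\<le>k. coeff (monom a k) i * c i)"
    by (rule mom_altdef) (rule degree_monom_le)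
  also have "\<dots> = (\<Sum>i\<le>k. if i = k then a * c k else 0)"
    by (intro sum.cong) auto
  finally show ?thesis by simp
qed

lemma mom_diff_moments: "mom (\<lambda>i. c i - d i) f = mom c f - mom d f"
  by (simp add: mom_def sum_subtractf algebra_simps)

lemma mom_smult_moments: "mom (\<lambda>i. a * c i) f = a * mom c f"
  by (simp add: mom_def sum_distrib_left mult_ac)

lemma mom_powers: "mom (\<lambda>i. z ^ i) f = poly f z"
  by (simp add: mom_def poly_altdef)

text \<open>Identifies the functional on products with the bilinear form of
  \<open>hankel n c\<close>, which is the link between polynomials and matrices.\<close>

lemma mom_mult:
  assumes "degree f < n" "degree g < n"
  shows "mom c (f * g) = (\<Sum>i<n. \<Sum>j<n. coeff f i * coeff g j * c (i + j))"
proof -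
  have *: "h = (\<Sum>i<n. monom (coeff h i) i)" if "degree h < n" for h :: "real poly"
    using poly_as_sum_of_monoms'[of h "n - 1"] that
    by (cases n) (simp_all add: lessThan_Suc_atMost)
  have "f * g = (\<Sum>i<n. \<Sum>j<n. monom (coeff f i * coeff g j) (i + j))"
    by (subst *[OF assms(1)], subst *[OF assms(2)]) (simp add: sum_product mult_monom)
  then show ?thesis by (simp add: mom_sum mom_monom)
qed

lemma mom_canonical_rep:
  assumes "canonical_rep n c x \<rho>" "degree f \<le> 2 * n - 2"
  shows "mom c f = (\<Sum>j=1..n. \<rho> j * poly f (x j))"
proof -
  have "mom c f = (\<Sum>i\<le>degree f. \<Sum>j=1..n. \<rho> j * (coeff f i * x j ^ i))"
    using assms unfolding mom_def canonical_rep_def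
    by (intro sum.cong) (auto simp: sum_distrib_left mult_ac)
  also have "\<dots> = (\<Sum>j=1..n. \<rho> j * poly f (x j))"
    by (subst sum.swap) (simp add: poly_altdef sum_distrib_left)
  finally show ?thesis .
qed

text \<open>The mass at infinity enters only the moment of order \<open>2 * n - 2\<close>, hence
  sees only the coefficient of that order.\<close>

lemma mom_canonical_rep_inf:
  assumes "canonical_rep_inf n c t \<sigma> l" "n \<ge> 2" "degree f \<le> 2 * n - 2"
  shows "mom c f = (\<Sum>j=1..n-1. \<sigma> j * poly f (t j)) + l * coeff f (2 * n - 2)"
proof -
  define N where "N = 2 * n - 2"
  have c: "c i = (\<Sum>j=1..n-1. \<sigma> j * t j ^ i) + (if i = N then l else 0)" if "i \<le> N" for i
  proof (cases "i = N")
    case False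
    then have "i \<le> 2 * n - 3" using that by (simp add: N_def)
    then show ?thesis using False assms(1) by (simp add: canonical_rep_inf_def)
  qed (use assms(1) in \<open>simp add: canonical_rep_inf_def N_def\<close>)
  have "mom c f = (\<Sum>i\<le>N. coeff f i * ((\<Sum>j=1..n-1. \<sigma> j * t j ^ i) + (if i = N then l else 0)))"
    using assms(3) c by (subst mom_altdef[of f N]) (auto simp: N_def intro!: sum.cong)
  also have "\<dots> = (\<Sum>i\<le>N. \<Sum>j=1..n-1. \<sigma> j * (coeff f i * t j ^ i)) + (\<Sum>i\<le>N. if i = N then l * coeff f N else 0)"
    unfolding sum.distrib[symmetric]
    by (intro sum.cong) (auto simp: sum_distrib_left algebra_simps)
  also have "(\<Sum>i\<le>N. \<Sum>j=1..n-1. \<sigma> j * (coeff f i * t j ^ i)) = (\<Sum>j=1..n-1. \<sigma> j * poly f (t j))"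
    using mom_altdef[of f N "\<lambda>i. _ ^ i"] assms(3)
    by (subst sum.swap) (simp add: N_def mom_powers[symmetric] sum_distrib_left)
  finally show ?thesis by (simp add: N_def)
qed

section \<open>The Nesterov mapping in terms of an orthogonal basis\<close>

text \<open>Anti-diagonal sums of the rank-one matrix built from the coefficients of
  \<open>q l\<close> are a convolution, that is, the coefficients of the square of
  \<open>q l\<close>.\<close>

lemma coeff_sum_squares:
  fixes q :: "'l \<Rightarrow> real poly"
  assumes "\<And>l. l \<in> A \<Longrightarrow> degree (q l) < n"
  shows "(\<Sum>(i, j) | i < n \<and> j < n \<and> i + j = k. \<Sum>l\<in>A. coeff (q l) i * coeff (q l) j / d l)
    = coeff (\<Sum>l\<in>A. smult (1 / d l) ((q l)\<^sup>2)) k"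
proof -
  have "(\<Sum>(i, j) | i < n \<and> j < n \<and> i + j = k. \<Sum>l\<in>A. coeff (q l) i * coeff (q l) j / d l)
    = (\<Sum>l\<in>A. \<Sum>(i, j) | i < n \<and> j < n \<and> i + j = k. coeff (q l) i * coeff (q l) j / d l)"
    unfolding case_prod_unfold by (rule sum.swap)
  also have "\<dots> = (\<Sum>l\<in>A. coeff (smult (1 / d l) ((q l)\<^sup>2)) k)"
  proof (rule sum.cong[OF refl])
    fix l assume "l \<in> A"
    have "(\<Sum>(i, j) | i < n \<and> j < n \<and> i + j = k. coeff (q l) i * coeff (q l) j / d l)
      = (\<Sum>i | i \<le> k \<and> i < n \<and> k - i < n. coeff (q l) i * coeff (q l) (k - i) / d l)"
      by (rule sum.reindex_bij_witness[of _ "\<lambda>i. (i, k - i)" fst]) auto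
    also have "\<dots> = (\<Sum>i\<le>k. coeff (q l) i * coeff (q l) (k - i) / d l)"
    proof (rule sum.mono_neutral_left)
      have "coeff (q l) i = 0" if "\<not> i < n" for i
        using assms[OF \<open>l \<in> A\<close>] that by (intro coeff_eq_0) simp
      then show "\<forall>i\<in>{..k} - {i. i \<le> k \<and> i < n \<and> k - i < n}. coeff (q l) i * coeff (q l) (k - i) / d l = 0"
        by auto
    qed auto
    finally show "(\<Sum>(i, j) | i < n \<and> j < n \<and> i + j = k. coeff (q l) i * coeff (q l) j / d l)
      = coeff (smult (1 / d l) ((q l)\<^sup>2)) k"
      by (simp add: power2_eq_square coeff_mult sum_divide_distrib)
  qed
  finally show ?thesis by (simp add: coeff_sum)
qed

text \<open>If the rows of \<open>Q\<close> are the coefficients of the \<open>q k\<close>,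
  orthogonality says that \<open>Q\<close> transforms the Hankel form \<open>H\<close> to the
  diagonal form of \<open>d\<close>. Inverting gives \<open>G\<close> as the inverse of
  \<open>H\<close>, a weighted sum of rank-one matrices, and \<open>coeff_sum_squares\<close>
  computes its anti-diagonal sums.\<close>

lemma nesterov_dual_basis:
  assumes deg: "\<And>k. k \<in> {1..n} \<Longrightarrow> degree (q k) < n"
    and d: "\<And>k. k \<in> {1..n} \<Longrightarrow> d k \<noteq> 0"
    and orth: "\<And>k l. k \<in> {1..n} \<Longrightarrow> l \<in> {1..n} \<Longrightarrow> mom c (q k * q l) = (if k = l then d k else 0)"
  shows "nesterov n c = Some (coeff (\<Sum>k=1..n. smult (1 / d k) ((q k)\<^sup>2)))"
proof -
  define H where "H = hankel n c"
  define Q where "Q = mat n n (\<lambda>(k, i). coeff (q (Suc k)) i)"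
  define G where "G = mat n n (\<lambda>(i, j). \<Sum>l=1..n. coeff (q l) i * coeff (q l) j / d l)"
  \<comment> \<open>\<open>R\<close> is \<open>H\<close> times the transpose of \<open>Q\<close>,
    with column \<open>l\<close> divided by \<open>d (Suc l)\<close>. Orthogonality reads
    \<open>Q * R = 1\<close>, while \<open>R * Q\<close> is \<open>H * G\<close>, so exchanging the
    factors inverts \<open>H\<close>.\<close>
  define R where "R = mat n n (\<lambda>(i, l). (\<Sum>j<n. c (i + j) * coeff (q (Suc l)) j) / d (Suc l))"
  have carr: "H \<in> carrier_mat n n" "Q \<in> carrier_mat n n" "G \<in> carrier_mat n n" "R \<in> carrier_mat n n"
    by (auto simp: H_def hankel_def Q_def G_def R_def)
  have "Q * R = 1\<^sub>m n"
  proof (rule eq_matI)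
    fix k l assume kl: "k < dim_row (1\<^sub>m n :: real mat)" "l < dim_col (1\<^sub>m n :: real mat)"
    then have "(Q * R) $$ (k, l)
      = (\<Sum>i<n. coeff (q (Suc k)) i * ((\<Sum>j<n. c (i + j) * coeff (q (Suc l)) j) / d (Suc l)))"
      by (simp add: Q_def R_def scalar_prod_def atLeast0LessThan)
    also have "\<dots> = mom c (q (Suc k) * q (Suc l)) / d (Suc l)"
      using kl deg[of "Suc k"] deg[of "Suc l"]
      by (subst mom_mult[of _ n]) (auto simp: sum_divide_distrib sum_distrib_left mult_ac)
    also have "\<dots> = 1\<^sub>m n $$ (k, l)"
      using kl orth[of "Suc k" "Suc l"] d[of "Suc l"] by auto
    finally show "(Q * R) $$ (k, l) = 1\<^sub>m n $$ (k, l)" .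
  qed (auto simp: Q_def R_def)
  then have "R * Q = 1\<^sub>m n"
    using carr mat_mult_left_right_inverse by blast
  moreover have "H * G = R * Q"
  proof (rule eq_matI)
    fix i i' assume ii: "i < dim_row (R * Q)" "i' < dim_col (R * Q)"
    then have "(H * G) $$ (i, i')
      = (\<Sum>j<n. c (i + j) * (\<Sum>l=1..n. coeff (q l) j * coeff (q l) i' / d l))"
      by (simp add: H_def hankel_def G_def R_def Q_def scalar_prod_def atLeast0LessThan)
    also have "\<dots> = (\<Sum>l=1..n. (\<Sum>j<n. c (i + j) * coeff (q l) j) / d l * coeff (q l) i')"
      unfolding sum_distrib_left sum_distrib_right sum_divide_distrib
      by (subst sum.swap) (simp add: mult_ac)
    also have "\<dots> = (\<Sum>l<n. (\<Sum>j<n. c (i + j) * coeff (q (Suc l)) j) / d (Suc l) * coeff (q (Suc l)) i')"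
      by (rule sum.reindex_bij_witness[of _ Suc "\<lambda>l. l - 1"]) auto
    also have "\<dots> = (R * Q) $$ (i, i')"
      using ii by (simp add: R_def Q_def scalar_prod_def atLeast0LessThan)
    finally show "(H * G) $$ (i, i') = (R * Q) $$ (i, i')" .
  qed (use carr in auto)
  ultimately have HG: "H * G = 1\<^sub>m n" by simp
  then have GH: "G * H = 1\<^sub>m n" using carr mat_mult_left_right_inverse by blast
  \<comment> \<open>Being a unit, \<open>H\<close> is not mapped to \<open>None\<close> by
    \<open>mat_inverse\<close>; the returned matrix is then \<open>G\<close> by uniqueness of
    inverses.\<close>
  have "H \<in> Units (ring_mat TYPE(real) n ())"
    using carr HG GH by (auto simp: Units_def ring_mat_def)
  then obtain B where B: "mat_inverse H = Some B"
    using mat_inverse(1)[OF carr(1), where b = "()"] by blast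
  then have "B * H = 1\<^sub>m n" "B \<in> carrier_mat n n"
    using mat_inverse(2)[OF carr(1)] by auto
  have "B = B * (H * G)" using \<open>B \<in> carrier_mat n n\<close> by (simp add: HG)
  also have "\<dots> = (B * H) * G"
    using \<open>B \<in> carrier_mat n n\<close> carr(1,3) by (rule assoc_mult_mat[symmetric])
  also have "\<dots> = G" using \<open>B * H = 1\<^sub>m n\<close> carr(3) by simp
  finally have "B = G" .
  moreover have "antidiag_sums G = coeff (\<Sum>k=1..n. smult (1 / d k) ((q k)\<^sup>2))"
  proof (rule ext)
    fix k
    have "antidiag_sums G k
      = (\<Sum>(i, j) | i < n \<and> j < n \<and> i + j = k. \<Sum>l=1..n. coeff (q l) i * coeff (q l) j / d l)"
      unfolding antidiag_sums_def by (intro sum.cong) (auto simp: G_def)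
    then show "antidiag_sums G k = coeff (\<Sum>k=1..n. smult (1 / d k) ((q k)\<^sup>2)) k"
      using coeff_sum_squares[where A = "{1..n}" and q = q and n = n] deg by auto
  qed
  ultimately show ?thesis using B by (simp add: nesterov_def H_def)
qed

section \<open>Positive definite Hankel forms and canonical representations\<close>

text \<open>By \<open>mom_mult\<close> this is positive definiteness of \<open>hankel n c\<close>,
  phrased for polynomials instead of coefficient vectors.\<close>

definition posdef :: "nat \<Rightarrow> (nat \<Rightarrow> real) \<Rightarrow> bool" where
  "posdef n c \<longleftrightarrow> (\<forall>f. f \<noteq> 0 \<longrightarrow> degree f < n \<longrightarrow> mom c (f\<^sup>2) > 0)"

lemma degree_mult_less_le:
  fixes f g :: "real poly"
  assumes "degree f < n" "degree g < n"
  shows "degree (f * g) \<le> 2 * n - 2"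
  using degree_mult_le[of f g] assms by linarith

lemma degree_power2_less_le:
  "degree f < n \<Longrightarrow> degree (f\<^sup>2) \<le> 2 * n - 2" for f :: "real poly"
  by (simp add: power2_eq_square degree_mult_less_le)

text \<open>The quadrature is exact on products of two Lagrange polynomials, where it leaves only
  the weight of a common node; so they form a basis as in
  \<open>nesterov_dual_basis\<close>.\<close>

lemma nesterov_canonical_rep:
  assumes rep: "canonical_rep n c x \<rho>" and inj: "inj_on x {1..n}"
    and pos: "\<And>k. k \<in> {1..n} \<Longrightarrow> \<rho> k > 0"
  shows "nesterov n c = Some (coeff (\<Sum>k=1..n. smult (1 / \<rho> k) ((lagrange_poly x {1..n} k)\<^sup>2)))"
proof (rule nesterov_dual_basis)
  show deg: "degree (lagrange_poly x {1..n} k) < n" if "k \<in> {1..n}" for k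
    using degree_lagrange_poly[of "{1..n}" k x] that by simp
  show "\<rho> k \<noteq> 0" if "k \<in> {1..n}" for k
    using pos[OF that] by simp
  fix k l assume kl: "k \<in> {1..n}" "l \<in> {1..n}"
  have "mom c (lagrange_poly x {1..n} k * lagrange_poly x {1..n} l)
    = (\<Sum>j=1..n. \<rho> j * (poly (lagrange_poly x {1..n} k) (x j) * poly (lagrange_poly x {1..n} l) (x j)))"
    using mom_canonical_rep[OF rep degree_mult_less_le[OF deg[OF kl(1)] deg[OF kl(2)]]] by simp
  also have "\<dots> = (\<Sum>j=1..n. if j = k then if k = l then \<rho> k else 0 else 0)"
    using kl inj by (intro sum.cong) (auto simp: poly_lagrange_poly)
  finally show "mom c (lagrange_poly x {1..n} k * lagrange_poly x {1..n} l) = (if k = l then \<rho> k else 0)"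
    using kl by simp
qed

text \<open>The nodal polynomial, placed at index \<open>n\<close> of the basis, vanishes at all
  nodes and sees only the mass \<open>l\<close>. The Lagrange polynomials have degree below
  \<open>n - 1\<close>, so a product involving one of them has degree below \<open>2 * n - 2\<close>
  and does not see that mass.\<close>

lemma nesterov_canonical_rep_inf:
  assumes rep: "canonical_rep_inf n c t \<sigma> l" and n: "n \<ge> 2" and inj: "inj_on t {1..n-1}"
    and pos: "\<And>k. k \<in> {1..n-1} \<Longrightarrow> \<sigma> k > 0" "l > 0"
  shows "nesterov n c = Some (coeff ((\<Sum>k=1..n-1. smult (1 / \<sigma> k) ((lagrange_poly t {1..n-1} k)\<^sup>2))
      + smult (1 / l) ((root_poly t {1..n-1})\<^sup>2)))"
proof -
  define A where "A = {1..n-1}"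
  define q where "q k = (if k = n then root_poly t A else lagrange_poly t A k)" for k
  define d where "d k = (if k = n then l else \<sigma> k)" for k
  have split: "{1..n} = insert n A" and nA: "n \<notin> A" "finite A" "card A = n - 1"
    using n by (auto simp: A_def)
  have degL: "degree (q k) < n - 1" if "k \<in> A" for k
    using that nA degree_lagrange_poly[of A k t] by (auto simp: q_def)
  have degw: "degree (q n) = n - 1" by (simp add: q_def degree_root_poly nA)
  have deg: "degree (q k) < n" if "k \<in> {1..n}" for k
  proof (cases "k = n")
    case False
    then have "k \<in> A" using that split by blast
    then show ?thesis using degL[of k] by simp
  qed (use degw n in simp)
  have val: "poly (q k) (t j) = (if k = n then 0 else if j = k then 1 else 0)"
    if "k \<in> {1..n}" "j \<in> A" for k j
  proof (cases "k = n")
    case True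
    then show ?thesis using that nA poly_root_poly_eq_0_iff[of A t "t j"] by (auto simp: q_def)
  next
    case False
    then have "k \<in> A" using that split by blast
    then show ?thesis
      using that nA(2) inj False poly_lagrange_poly[of A t k j] by (simp add: q_def A_def)
  qed
  have top: "coeff (q k * q j) (2 * n - 2) = (if k = n \<and> j = n then 1 else 0)"
    if "k \<in> {1..n}" "j \<in> {1..n}" for k j
  proof (cases "k = n \<and> j = n")
    case True
    have "coeff (q n * q n) (degree (q n) + degree (q n)) = 1"
      using monic_root_poly[of t A] nA degw unfolding coeff_mult_degree_sum by (simp add: q_def)
    moreover have "degree (q n) + degree (q n) = 2 * n - 2" using degw by simp
    ultimately show ?thesis using True by simp
  next
    case False
    then have "k \<in> A \<or> j \<in> A" using that split False by blast
    then have "degree (q k) + degree (q j) < 2 * n - 2"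
      using degL[of k] degL[of j] deg[OF that(1)] deg[OF that(2)] by linarith
    then have "degree (q k * q j) < 2 * n - 2" using degree_mult_le[of "q k" "q j"] by linarith
    then show ?thesis using False by (simp add: coeff_eq_0)
  qed
  have "nesterov n c = Some (coeff (\<Sum>k=1..n. smult (1 / d k) ((q k)\<^sup>2)))"
  proof (rule nesterov_dual_basis)
    fix k j assume kj: "k \<in> {1..n}" "j \<in> {1..n}"
    have deg: "degree (q k * q j) \<le> 2 * n - 2"
      using kj deg by (intro degree_mult_less_le) auto
    have "mom c (q k * q j) = (\<Sum>i\<in>A. \<sigma> i * poly (q k * q j) (t i)) + l * coeff (q k * q j) (2 * n - 2)"
      using mom_canonical_rep_inf[OF rep n deg] by (simp add: A_def)
    also have "(\<Sum>i\<in>A. \<sigma> i * poly (q k * q j) (t i)) = (\<Sum>i\<in>A. if i = k then if j = k then \<sigma> k else 0 else 0)"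
      using kj nA by (intro sum.cong) (auto simp: val)
    also have "\<dots> + l * coeff (q k * q j) (2 * n - 2) = (if k = j then d k else 0)"
    proof -
      have "k \<in> A \<or> k = n" using kj split by blast
      then show ?thesis using nA(1,2) unfolding top[OF kj] by (auto simp: d_def)
    qed
    finally show "mom c (q k * q j) = (if k = j then d k else 0)" .
  next
    fix k assume "k \<in> {1..n}"
    then have "k \<in> A \<or> k = n" using split by blast
    then show "d k \<noteq> 0" using pos(1)[of k] pos(2) by (auto simp: d_def A_def)
  qed (rule deg)
  moreover have "(\<Sum>k=1..n. smult (1 / d k) ((q k)\<^sup>2))
    = (\<Sum>k\<in>A. smult (1 / \<sigma> k) ((lagrange_poly t A k)\<^sup>2)) + smult (1 / l) ((root_poly t A)\<^sup>2)"
  proof -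
    have "(\<Sum>k\<in>A. smult (1 / d k) ((q k)\<^sup>2)) = (\<Sum>k\<in>A. smult (1 / \<sigma> k) ((lagrange_poly t A k)\<^sup>2))"
      using nA(1) by (intro sum.cong refl) (auto simp: q_def d_def)
    then show ?thesis
      unfolding split sum.insert[OF nA(2,1)] by (simp add: q_def d_def add.commute)
  qed
  ultimately show ?thesis by (simp add: A_def)
qed

text \<open>If nodes coincide, the nodal polynomial of the distinct values has degree below
  \<open>n\<close>, and the moment of its square is zero.\<close>

lemma posdef_inj_canonical_rep:
  assumes "posdef n c" "canonical_rep n c x \<rho>"
  shows "inj_on x {1..n}"
proof (rule ccontr)
  assume "\<not> inj_on x {1..n}"
  then have card: "card (x ` {1..n}) < n"
    using card_image_le[of "{1..n}" x] inj_on_iff_eq_card[of "{1..n}" x] by fastforce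
  define f where "f = root_poly id (x ` {1..n})"
  have "degree f < n" using card by (simp add: f_def degree_root_poly)
  then have "mom c (f\<^sup>2) = (\<Sum>j=1..n. \<rho> j * poly (f\<^sup>2) (x j))"
    by (intro mom_canonical_rep assms degree_power2_less_le)
  also have "\<dots> = 0" by (intro sum.neutral) (auto simp: f_def poly_root_poly_eq_0_iff)
  finally have "mom c (f\<^sup>2) = 0" .
  moreover have "f \<noteq> 0" by (simp add: f_def)
  ultimately show False using assms(1) \<open>degree f < n\<close> unfolding posdef_def by (metis less_irrefl)
qed

text \<open>The same argument; here the degree of the nodal polynomial drops below
  \<open>n - 1\<close>, which keeps its square clear of the mass at infinity.\<close>

lemma posdef_inj_canonical_rep_inf:
  assumes "posdef n c" "canonical_rep_inf n c t \<sigma> l" "n \<ge> 2"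
  shows "inj_on t {1..n-1}"
proof (rule ccontr)
  assume "\<not> inj_on t {1..n-1}"
  then have card: "card (t ` {1..n-1}) < n - 1"
    using card_image_le[of "{1..n-1}" t] inj_on_iff_eq_card[of "{1..n-1}" t] by fastforce
  define f where "f = root_poly id (t ` {1..n-1})"
  have deg: "degree f < n - 1" using card by (simp add: f_def degree_root_poly)
  then have deg2: "degree (f\<^sup>2) \<le> 2 * (n - 1) - 2"
    by (intro degree_power2_less_le)
  moreover have "0 < n - 1" using assms(3) by simp
  ultimately have deg3: "degree (f\<^sup>2) < 2 * n - 2" by linarith
  have "mom c (f\<^sup>2) = (\<Sum>j=1..n-1. \<sigma> j * poly (f\<^sup>2) (t j)) + l * coeff (f\<^sup>2) (2 * n - 2)"
    using deg3 by (intro mom_canonical_rep_inf assms) auto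
  also have "(\<Sum>j=1..n-1. \<sigma> j * poly (f\<^sup>2) (t j)) = 0"
    by (intro sum.neutral) (auto simp: f_def poly_root_poly_eq_0_iff)
  also have "coeff (f\<^sup>2) (2 * n - 2) = 0" using deg3 by (rule coeff_eq_0)
  finally have "mom c (f\<^sup>2) = 0" by simp
  moreover have "f \<noteq> 0" "degree f < n" using deg by (auto simp: f_def)
  ultimately show False using assms(1) unfolding posdef_def by (metis less_irrefl)
qed

lemma posdef_canonical_rep:
  assumes rep: "canonical_rep n c x \<rho>" and inj: "inj_on x {1..n}"
    and pos: "\<And>k. k \<in> {1..n} \<Longrightarrow> \<rho> k > 0"
  shows "posdef n c"
  unfolding posdef_def
proof safe
  fix f :: "real poly" assume f: "f \<noteq> 0" "degree f < n"
  obtain k where k: "k \<in> {1..n}" "poly f (x k) \<noteq> 0"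
    using poly_eq_0_many_roots[of "{1..n}" x f] inj f by auto
  have "0 < (\<Sum>j=1..n. \<rho> j * poly (f\<^sup>2) (x j))"
    using k pos by (intro sum_pos2[of _ k]) (auto simp: less_imp_le)
  then show "mom c (f\<^sup>2) > 0"
    using mom_canonical_rep[OF rep] f by (simp add: degree_power2_less_le)
qed

text \<open>A nonzero polynomial of degree below \<open>n - 1\<close> is detected by one of the
  nodes, one of degree \<open>n - 1\<close> by the mass at infinity.\<close>

lemma posdef_canonical_rep_inf:
  assumes rep: "canonical_rep_inf n c t \<sigma> l" and n: "n \<ge> 2" and inj: "inj_on t {1..n-1}"
    and pos: "\<And>k. k \<in> {1..n-1} \<Longrightarrow> \<sigma> k > 0" "l > 0"
  shows "posdef n c"
  unfolding posdef_def
proof safe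
  fix f :: "real poly" assume f: "f \<noteq> 0" "degree f < n"
  have m: "mom c (f\<^sup>2) = (\<Sum>j=1..n-1. \<sigma> j * poly (f\<^sup>2) (t j)) + l * coeff (f\<^sup>2) (2 * n - 2)"
    by (intro mom_canonical_rep_inf[OF rep n] degree_power2_less_le f)
  have s: "0 \<le> (\<Sum>j=1..n-1. \<sigma> j * poly (f\<^sup>2) (t j))"
    using pos by (intro sum_nonneg) (auto simp: less_imp_le)
  show "mom c (f\<^sup>2) > 0"
  proof (cases "degree f < n - 1")
    case True
    obtain k where k: "k \<in> {1..n-1}" "poly f (t k) \<noteq> 0"
      using poly_eq_0_many_roots[of "{1..n-1}" t f] inj f True by auto
    have "0 < (\<Sum>j=1..n-1. \<sigma> j * poly (f\<^sup>2) (t j))"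
      using k pos by (intro sum_pos2[of _ k]) (auto simp: less_imp_le)
    moreover have "degree (f\<^sup>2) < 2 * n - 2" using True by (simp add: degree_power_eq f)
    ultimately show ?thesis unfolding m by (simp add: coeff_eq_0)
  next
    case False
    then have "degree f = n - 1" using f by simp
    then have "coeff (f\<^sup>2) (2 * n - 2) = (lead_coeff f)\<^sup>2"
      using coeff_mult_degree_sum[of f f] by (simp add: power2_eq_square mult_2[symmetric] right_diff_distrib')
    then show ?thesis unfolding m using s f pos by (simp add: add_nonneg_pos)
  qed
qed

section \<open>Interiors of the cones\<close>

text \<open>Basic open sets of the product topology constrain finitely many coordinates, and on the
  subspace all coordinates from \<open>d\<close> on vanish. Hence cubes in the first
  \<open>d\<close> coordinates form a neighbourhood base.\<close>

lemma interior_of_Euclidean_space_iff: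
  "c \<in> Euclidean_space d interior_of S \<longleftrightarrow> c \<in> topspace (Euclidean_space d) \<and>
    (\<exists>e>0. \<forall>c'\<in>topspace (Euclidean_space d). (\<forall>i<d. \<bar>c' i - c i\<bar> < e) \<longrightarrow> c' \<in> S)"
proof safe
  assume "c \<in> Euclidean_space d interior_of S"
  then obtain T where T: "openin (Euclidean_space d) T" "c \<in> T" "T \<subseteq> S"
    by (auto simp: interior_of_def)
  then show "c \<in> topspace (Euclidean_space d)" using openin_subset by blast
  from T obtain U where U: "openin (powertop_real UNIV) U" "T = U \<inter> {x. \<forall>i\<ge>d. x i = 0}"
    by (auto simp: Euclidean_space_def openin_subtopology)
  have "\<forall>x\<in>U. \<exists>V. finite {i. V i \<noteq> UNIV} \<and> (\<forall>i. open (V i)) \<and> x \<in> PiE UNIV V \<and> PiE UNIV V \<subseteq> U"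
    using U(1) unfolding openin_product_topology_alt by simp
  moreover have "c \<in> U" using T(2) U(2) by simp
  ultimately obtain V where V: "\<And>i. open (V i)" "c \<in> PiE UNIV V" "PiE UNIV V \<subseteq> U"
    by (meson bspec)
  have "\<exists>r>0. ball (c i) r \<subseteq> V i" for i
  proof -
    have "c i \<in> V i" using V(2) by (rule PiE_mem) simp
    then show ?thesis using V(1)[of i] open_contains_ball by metis
  qed
  then obtain r where r: "\<And>i. r i > 0" "\<And>i. ball (c i) (r i) \<subseteq> V i" by metis
  \<comment> \<open>The inserted 1 keeps the minimum meaningful for \<open>d = 0\<close>.\<close>
  define e where "e = Min (insert 1 (r ` {..<d}))"
  have "e > 0" using r by (auto simp: e_def)
  moreover have "c' \<in> S" if c': "c' \<in> topspace (Euclidean_space d)" "\<forall>i<d. \<bar>c' i - c i\<bar> < e" for c'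
  proof -
    have "c' i \<in> V i" for i
    proof (cases "i < d")
      case True
      then have "e \<le> r i" by (auto simp: e_def)
      then have "c' i \<in> ball (c i) (r i)" using c'(2) True by (fastforce simp: dist_real_def)
      then show ?thesis using r by blast
    next
      case False
      then have "c' i = c i"
        using c'(1) \<open>c \<in> topspace (Euclidean_space d)\<close> by (simp add: topspace_Euclidean_space)
      then show ?thesis using V(2) by auto
    qed
    then have "c' \<in> U" using V(3) by auto
    then have "c' \<in> T" using U(2) c'(1) by (simp add: topspace_Euclidean_space)
    then show ?thesis using T(3) by blast
  qed
  ultimately show "\<exists>e>0. \<forall>c'\<in>topspace (Euclidean_space d). (\<forall>i<d. \<bar>c' i - c i\<bar> < e) \<longrightarrow> c' \<in> S"
    by blast
next
  fix e :: real assume c: "c \<in> topspace (Euclidean_space d)" and "e > 0"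
    and e: "\<forall>c'\<in>topspace (Euclidean_space d). (\<forall>i<d. \<bar>c' i - c i\<bar> < e) \<longrightarrow> c' \<in> S"
  define V where "V i = (if i < d then ball (c i) e else UNIV)" for i
  have "finite {i. V i \<noteq> UNIV}"
    by (rule finite_subset[of _ "{..<d}"]) (auto simp: V_def)
  then have "open (PiE UNIV V)"
    by (intro open_PiE) (auto simp: V_def)
  then have op: "openin (Euclidean_space d) (PiE UNIV V \<inter> topspace (Euclidean_space d))"
    unfolding Euclidean_space_def openin_subtopology
    by (auto simp: euclidean_product_topology)
  have "PiE UNIV V \<inter> topspace (Euclidean_space d) \<subseteq> S"
  proof safe
    fix c' assume c': "c' \<in> PiE UNIV V" "c' \<in> topspace (Euclidean_space d)"
    have "\<bar>c' i - c i\<bar> < e" if "i < d" for i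
      using PiE_mem[OF c'(1), of i] that by (simp add: V_def dist_real_def abs_minus_commute)
    then show "c' \<in> S" using e c' by blast
  qed
  moreover have "c \<in> PiE UNIV V" using \<open>e > 0\<close> by (auto simp: V_def)
  ultimately show "c \<in> Euclidean_space d interior_of S"
    using op c unfolding interior_of_def by blast
qed

section \<open>Interior points of the cone of nonnegative polynomials\<close>

lemma coeff_nonneg_poly:
  fixes q :: "real poly"
  assumes "degree q \<le> N" "\<And>x. poly q x \<ge> 0"
  shows "coeff q N \<ge> 0"
proof (cases "degree q = N \<and> lead_coeff q < 0")
  case True
  then have "lead_coeff (- q) > 0" by auto
  then obtain m where "\<forall>x\<ge>m. poly (- q) x \<ge> lead_coeff (- q)" using poly_pinfty_gt_lc by blast
  then have "poly (- q) m \<ge> lead_coeff (- q)" by simp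
  then show ?thesis using \<open>lead_coeff (- q) > 0\<close> assms(2)[of m] by simp
next
  case False
  then show ?thesis using assms(1) by (cases "degree q = N") (auto simp: coeff_eq_0)
qed

text \<open>An interior point stays in the cone after subtracting a small multiple of
  \<open>1 + x ^ (2 * n - 2)\<close>. The resulting lower bound supplies positivity, the exact
  degree, and the growth needed for the existence of a maximiser.\<close>

lemma int_nonneg_coneD:
  assumes n: "n \<ge> 2" and p: "coeff p \<in> int_nonneg_cone n"
  shows "degree p = 2 * n - 2" "coeff p (2 * n - 2) > 0"
    and "\<exists>e>0. \<forall>x. poly p x \<ge> e * (1 + x ^ (2 * n - 2))"
proof -
  define N where "N = 2 * n - 2"
  have N: "N > 0" "2 * n - 1 = Suc N" using n by (auto simp: N_def)
  obtain e where top: "coeff p \<in> topspace (Euclidean_space (Suc N))" and e: "e > 0"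
    "\<And>c'. c'\<in>topspace (Euclidean_space (Suc N)) \<Longrightarrow> \<forall>i<Suc N. \<bar>c' i - coeff p i\<bar> < e \<Longrightarrow> c' \<in> nonneg_cone n"
    using p unfolding int_nonneg_cone_def interior_of_Euclidean_space_iff N by blast
  have deg: "degree p \<le> N"
    using top by (intro degree_le) (auto simp: topspace_Euclidean_space)
  \<comment> \<open>The factor \<open>e / 2\<close> keeps the perturbation strictly below
    \<open>e\<close>; since \<open>N > 0\<close>, the constant and the top coefficient are different
    entries.\<close>
  define q where "q = p - smult (e / 2) (1 + monom 1 N)"
  have "coeff q \<in> nonneg_cone n"
  proof (rule e(2))
    show "coeff q \<in> topspace (Euclidean_space (Suc N))"
      using deg by (auto simp: topspace_Euclidean_space q_def coeff_eq_0 N(1))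
    show "\<forall>i<Suc N. \<bar>coeff q i - coeff p i\<bar> < e"
      using e(1) N(1) by (auto simp: q_def)
  qed
  then have q: "degree q \<le> N" "\<And>x. poly q x \<ge> 0"
    by (auto simp: nonneg_cone_def N_def coeff_inject)
  have "coeff q N \<ge> 0" by (rule coeff_nonneg_poly[OF q])
  then show pos: "coeff p (2 * n - 2) > 0"
    using e(1) N(1) by (simp add: q_def N_def[symmetric])
  show "degree p = 2 * n - 2"
    using deg le_degree[of p N] pos by (simp add: N_def)
  have "poly p x \<ge> e / 2 * (1 + x ^ N)" for x
    using q(2)[of x] by (simp add: q_def poly_monom)
  then show "\<exists>e>0. \<forall>x. poly p x \<ge> e * (1 + x ^ (2 * n - 2))"
    using e(1) unfolding N_def by (intro exI[of _ "e / 2"]) auto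
qed

section \<open>Interior points of the moment cone\<close>

lemma mom_moment_cone:
  assumes "c \<in> moment_cone n" "degree f \<le> 2 * n - 2" "\<And>x. poly f x \<ge> 0"
  shows "mom c f \<ge> 0"
proof -
  obtain M :: "real measure" where M: "sets M = sets borel"
    "\<And>k. k \<le> 2 * n - 2 \<Longrightarrow> integrable M (\<lambda>t. \<bar>t\<bar> ^ k)"
    "\<And>k. k \<le> 2 * n - 2 \<Longrightarrow> c k = (LINT t|M. t ^ k)"
    using assms(1) unfolding moment_cone_def by blast
  have [measurable_cong]: "sets M = sets borel" by (rule M(1))
  have [measurable]: "(\<lambda>t. t ^ k) \<in> borel_measurable M" for k by measurable
  have int: "integrable M (\<lambda>t. t ^ k)" if "k \<le> 2 * n - 2" for k
    using M(2)[OF that] by (rule Bochner_Integration.integrable_bound) (auto simp: power_abs)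
  have "mom c f = (\<Sum>i\<le>degree f. coeff f i * (LINT t|M. t ^ i))"
    using assms(2) M(3) by (simp add: mom_def)
  also have "\<dots> = (LINT t|M. (\<Sum>i\<le>degree f. coeff f i * t ^ i))"
    using int assms(2) by (subst Bochner_Integration.integral_sum) auto
  also have "\<dots> = (LINT t|M. poly f t)" by (simp add: poly_altdef)
  also have "\<dots> \<ge> 0" using assms(3) by simp
  finally show ?thesis .
qed

text \<open>Removing a small point mass at some \<open>x\<close> with
  \<open>poly f x \<noteq> 0\<close> stays in the moment cone, so the moment of the square of
  \<open>f\<close> exceeds zero by the removed contribution.\<close>

lemma int_moment_cone_posdef:
  assumes "n \<ge> 1" "c \<in> int_moment_cone n"
  shows "posdef n c"
  unfolding posdef_def
proof safe
  fix f :: "real poly" assume f: "f \<noteq> 0" "degree f < n"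
  obtain x where x: "poly f x \<noteq> 0" using poly_all_0_iff_0[of f] f(1) by auto
  define N where "N = 2 * n - 1"
  obtain e where c: "c \<in> topspace (Euclidean_space N)" and e: "e > 0"
    "\<And>c'. c'\<in>topspace (Euclidean_space N) \<Longrightarrow> \<forall>i<N. \<bar>c' i - c i\<bar> < e \<Longrightarrow> c' \<in> moment_cone n"
    using assms(2) unfolding int_moment_cone_def interior_of_Euclidean_space_iff N_def by blast
  \<comment> \<open>Chosen so that the moments of the removed mass of orders below \<open>N\<close>
    all stay strictly below \<open>e\<close>.\<close>
  define s where "s = e / (1 + (\<Sum>i<N. \<bar>x\<bar> ^ i))"
  have den: "1 + (\<Sum>i<N. \<bar>x\<bar> ^ i) > 0" by (intro add_pos_nonneg sum_nonneg) auto
  then have "s > 0" using e by (simp add: s_def)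
  define c' where "c' i = (if i < N then c i - s * x ^ i else 0)" for i
  have "c' \<in> moment_cone n"
  proof (rule e(2))
    show "\<forall>i<N. \<bar>c' i - c i\<bar> < e"
    proof safe
      fix i assume "i < N"
      then have "\<bar>x\<bar> ^ i \<le> (\<Sum>i<N. \<bar>x\<bar> ^ i)" by (intro member_le_sum) auto
      then have "s * \<bar>x\<bar> ^ i < s * (1 + (\<Sum>i<N. \<bar>x\<bar> ^ i))" using \<open>s > 0\<close> by simp
      also have "\<dots> = e" using den by (simp add: s_def)
      finally show "\<bar>c' i - c i\<bar> < e" using \<open>i < N\<close> \<open>s > 0\<close> by (simp add: c'_def abs_mult power_abs)
    qed
  qed (auto simp: c'_def topspace_Euclidean_space)
  then have "mom c' (f\<^sup>2) \<ge> 0"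
    using f by (intro mom_moment_cone degree_power2_less_le) auto
  moreover have "mom c' (f\<^sup>2) = mom (\<lambda>i. c i - s * x ^ i) (f\<^sup>2)"
    using degree_power2_less_le[OF f(2)] assms(1) unfolding mom_def
    by (intro sum.cong) (auto simp: c'_def N_def)
  ultimately have "mom c (f\<^sup>2) \<ge> s * (poly f x)\<^sup>2"
    by (simp add: mom_diff_moments mom_smult_moments mom_powers)
  moreover have "s * (poly f x)\<^sup>2 > 0" using \<open>s > 0\<close> x by simp
  ultimately show "mom c (f\<^sup>2) > 0" by linarith
qed

text \<open>The measure is the image under \<open>x\<close> of a weighted measure on the indices, so
  coinciding nodes simply add their weights.\<close>

lemma canonical_rep_moment_cone:
  assumes rep: "canonical_rep n c x \<rho>" and pos: "\<And>k. k \<in> {1..n} \<Longrightarrow> \<rho> k \<ge> 0"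
    and c: "c \<in> topspace (Euclidean_space (2 * n - 1))"
  shows "c \<in> moment_cone n"
proof -
  define M where "M = distr (point_measure {1..n} (\<lambda>k. ennreal (\<rho> k))) borel x"
  have int: "integrable M f" if [measurable]: "f \<in> borel_measurable borel" for f :: "real \<Rightarrow> real"
    unfolding M_def by (subst integrable_distr_eq) (auto intro: integrable_point_measure_finite)
  have val: "(LINT t|M. t ^ k) = (\<Sum>j=1..n. \<rho> j * x j ^ k)" for k
    unfolding M_def using pos
    by (subst integral_distr) (simp, simp, subst lebesgue_integral_point_measure_finite, auto)
  have "sets M = sets borel" by (simp add: M_def)
  moreover have "integrable M (\<lambda>t. \<bar>t\<bar> ^ k) \<and> c k = (LINT t|M. t ^ k)" if "k \<le> 2 * n - 2" for k
    using rep that by (auto simp: canonical_rep_def val intro!: int)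
  ultimately show ?thesis using c unfolding moment_cone_def by blast
qed

text \<open>The form of \<open>c\<close> is at least \<open>r * S\<close>, with \<open>S\<close> the
  sum of squared node values of \<open>f\<close>. Perturbing changes it by at most \<open>e\<close>
  times the squared sum of the absolute coefficients, and Lagrange interpolation with Cauchy-Schwarz
  bounds that sum by a multiple of \<open>S\<close>. The definition of \<open>e\<close> makes the
  change smaller than \<open>r * S\<close>.\<close>

lemma posdef_open:
  assumes rep: "canonical_rep n c x \<rho>" and inj: "inj_on x {1..n}"
    and pos: "\<And>k. k \<in> {1..n} \<Longrightarrow> \<rho> k > 0"
  shows "\<exists>e>0. \<forall>c'. (\<forall>i<2*n-1. \<bar>c' i - c i\<bar> < e) \<longrightarrow> posdef n c'"
proof -
  define A where "A = {1..n}"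
  define L where "L = lagrange_poly x A"
  define B where "B j = (\<Sum>i<n. \<bar>coeff (L j) i\<bar>)" for j
  define r where "r = Min (insert 1 (\<rho> ` A))"
  have r: "r > 0" using pos by (auto simp: r_def A_def)
  have r_le: "r \<le> \<rho> j" if "j \<in> A" for j
    unfolding r_def using that by (intro Min_le) (auto simp: A_def)
  define e where "e = r / (1 + (\<Sum>j\<in>A. (B j)\<^sup>2))"
  have den: "1 + (\<Sum>j\<in>A. (B j)\<^sup>2) > 0" by (intro add_pos_nonneg sum_nonneg) auto
  have "e > 0" using r den by (simp add: e_def)
  moreover have "posdef n c'" if c': "\<forall>i<2*n-1. \<bar>c' i - c i\<bar> < e" for c'
    unfolding posdef_def
  proof safe
    fix f :: "real poly" assume f: "f \<noteq> 0" "degree f < n"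
    define S where "S = (\<Sum>j\<in>A. (poly f (x j))\<^sup>2)"
    obtain k where k: "k \<in> A" "poly f (x k) \<noteq> 0"
      using poly_eq_0_many_roots[of A x f] inj f by (auto simp: A_def)
    have "S > 0" unfolding S_def using k by (intro sum_pos2[of _ k]) (auto simp: A_def)
    have "r * S \<le> (\<Sum>j\<in>A. \<rho> j * (poly f (x j))\<^sup>2)"
      unfolding S_def sum_distrib_left using r_le by (intro sum_mono mult_right_mono) auto
    also have "\<dots> = mom c (f\<^sup>2)"
      using mom_canonical_rep[OF rep degree_power2_less_le[OF f(2)]] by (simp add: A_def)
    finally have 1: "r * S \<le> mom c (f\<^sup>2)" .
    have f_eq: "(\<Sum>j\<in>A. smult (poly f (x j)) (L j)) = f"
      unfolding L_def using inj f by (intro lagrange_interpolation) (auto simp: A_def)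
    have "(\<Sum>i<n. \<bar>coeff f i\<bar>) = (\<Sum>i<n. \<bar>\<Sum>j\<in>A. poly f (x j) * coeff (L j) i\<bar>)"
      by (subst (1) f_eq[symmetric]) (simp add: coeff_sum)
    also have "\<dots> \<le> (\<Sum>i<n. \<Sum>j\<in>A. \<bar>poly f (x j)\<bar> * \<bar>coeff (L j) i\<bar>)"
      by (intro sum_mono order.trans[OF sum_abs]) (simp add: abs_mult)
    also have "\<dots> = (\<Sum>j\<in>A. \<bar>poly f (x j)\<bar> * B j)"
      by (subst sum.swap) (simp add: B_def sum_distrib_left)
    finally have "(\<Sum>i<n. \<bar>coeff f i\<bar>)\<^sup>2 \<le> (\<Sum>j\<in>A. \<bar>poly f (x j)\<bar> * B j)\<^sup>2"
      by (intro power_mono sum_nonneg) auto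
    also have "\<dots> \<le> S * (\<Sum>j\<in>A. (B j)\<^sup>2)"
      using Cauchy_Schwarz_ineq_sum[of "\<lambda>j. \<bar>poly f (x j)\<bar>" B A] by (simp add: S_def)
    finally have 2: "(\<Sum>i<n. \<bar>coeff f i\<bar>)\<^sup>2 \<le> S * (\<Sum>j\<in>A. (B j)\<^sup>2)" .
    have "\<bar>mom c' (f\<^sup>2) - mom c (f\<^sup>2)\<bar>
      = \<bar>\<Sum>i<n. \<Sum>j<n. coeff f i * coeff f j * (c' (i + j) - c (i + j))\<bar>"
      unfolding power2_eq_square mom_mult[OF f(2) f(2)]
      by (simp add: sum_subtractf right_diff_distrib)
    also have "\<dots> \<le> (\<Sum>i<n. \<Sum>j<n. \<bar>coeff f i\<bar> * \<bar>coeff f j\<bar> * e)"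
    proof (intro order.trans[OF sum_abs] sum_mono)
      fix i j assume ij: "i \<in> {..<n}" "j \<in> {..<n}"
      then have "\<bar>c' (i + j) - c (i + j)\<bar> \<le> e" using c' by (intro less_imp_le) auto
      then show "\<bar>coeff f i * coeff f j * (c' (i + j) - c (i + j))\<bar> \<le> \<bar>coeff f i\<bar> * \<bar>coeff f j\<bar> * e"
        by (simp add: abs_mult mult_left_mono)
    qed
    also have "\<dots> = e * (\<Sum>i<n. \<bar>coeff f i\<bar>)\<^sup>2"
      by (simp add: power2_eq_square sum_product sum_distrib_left mult_ac)
    also have "\<dots> \<le> e * (S * (\<Sum>j\<in>A. (B j)\<^sup>2))"
      using 2 \<open>e > 0\<close> by simp
    also have "\<dots> < e * (S * (1 + (\<Sum>j\<in>A. (B j)\<^sup>2)))"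
      using \<open>e > 0\<close> \<open>S > 0\<close> by simp
    also have "\<dots> = r * S" using den by (simp add: e_def)
    finally show "mom c' (f\<^sup>2) > 0" using 1 by linarith
  qed
  ultimately show ?thesis by blast
qed

section \<open>Gauss quadrature for positive definite moment sequences\<close>

lemma map_poly_complex_of_real_mult:
  "map_poly complex_of_real (p * q) = map_poly complex_of_real p * map_poly complex_of_real q"
  by (rule poly_eqI) (simp add: coeff_map_poly coeff_mult)

lemma map_poly_complex_of_real_add:
  "map_poly complex_of_real (p + q) = map_poly complex_of_real p + map_poly complex_of_real q"
  by (rule poly_eqI) (simp add: coeff_map_poly)

lemma poly_map_poly_complex_of_real:
  "poly (map_poly complex_of_real p) (of_real x) = of_real (poly p x)"
  by (induction p) (auto simp: map_poly_pCons)

lemma pderiv_map_poly_complex_of_real: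
  "pderiv (map_poly complex_of_real p) = map_poly complex_of_real (pderiv p)"
  by (rule poly_eqI) (simp add: coeff_map_poly coeff_pderiv)

lemma degree_map_poly_complex_of_real [simp]: "degree (map_poly complex_of_real p) = degree p"
  by (simp add: degree_map_poly)

text \<open>The lower coefficients of a monic orthogonal polynomial solve a linear system with
  matrix \<open>hankel n c\<close>. A kernel vector of this matrix would be a nonzero polynomial
  whose square has moment zero.\<close>

lemma posdef_orthogonal_poly:
  assumes "posdef n c"
  shows "\<exists>q. degree q = n \<and> lead_coeff q = 1 \<and> (\<forall>g. degree g < n \<longrightarrow> mom c (q * g) = 0)"
proof -
  define H where "H = hankel n c"
  have H: "H \<in> carrier_mat n n" by (simp add: H_def hankel_def)
  have "det H \<noteq> 0"
  proof
    assume "det H = 0"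
    then obtain v where v: "v \<in> carrier_vec n" "v \<noteq> 0\<^sub>v n" "H *\<^sub>v v = 0\<^sub>v n"
      using det_0_iff_vec_prod_zero_field[OF H] by auto
    define f where "f = (\<Sum>i<n. monom (v $ i) i)"
    have cf: "coeff f i = (if i < n then v $ i else 0)" for i
      by (auto simp: f_def coeff_sum)
    obtain i where i: "i < n" "v $ i \<noteq> 0"
      using v(1,2) by (metis eq_vecI carrier_vecD index_zero_vec)
    then have "f \<noteq> 0" using cf[of i] by auto
    have "n > 0" using i by simp
    then have deg: "degree f < n"
      using cf by (intro degree_lessI) auto
    have Hv: "(\<Sum>j<n. c (i + j) * v $ j) = 0" if "i < n" for i
    proof -
      have "(H *\<^sub>v v) $ i = 0" using v that by simp
      then show ?thesis using that v(1) by (simp add: H_def hankel_def scalar_prod_def atLeast0LessThan)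
    qed
    have "mom c (f\<^sup>2) = (\<Sum>i<n. v $ i * (\<Sum>j<n. c (i + j) * v $ j))"
      unfolding power2_eq_square mom_mult[OF deg deg]
      by (intro sum.cong) (auto simp: cf sum_distrib_left mult_ac)
    also have "\<dots> = 0" using Hv by (intro sum.neutral) auto
    finally show False using assms \<open>f \<noteq> 0\<close> deg unfolding posdef_def by (metis less_irrefl)
  qed
  then have "H \<in> Units (ring_mat TYPE(real) n ())"
    using det_non_zero_imp_unit[OF H, where b = "()"] by blast
  then obtain B where B: "B \<in> carrier_mat n n" "H * B = 1\<^sub>m n"
    by (auto simp: Units_def ring_mat_def)
  \<comment> \<open>The last entry \<open>c (2 * n - 1)\<close> lies outside the Hankel matrix;
    whatever its value, it selects one of the possible quadratures.\<close>
  define w where "w = vec n (\<lambda>k. c (n + k))"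
  define r where "r = B *\<^sub>v w"
  have r: "r \<in> carrier_vec n" using B by (simp add: r_def w_def)
  have "H *\<^sub>v r = w"
    using B H unfolding r_def by (subst assoc_mult_mat_vec[symmetric, of _ n n _ n]) (auto simp: w_def)
  then have Hr: "(\<Sum>j<n. c (i + j) * r $ j) = c (n + i)" if "i < n" for i
  proof -
    have "(H *\<^sub>v r) $ i = w $ i" using \<open>H *\<^sub>v r = w\<close> by simp
    then show ?thesis using that r by (simp add: H_def hankel_def scalar_prod_def atLeast0LessThan w_def)
  qed
  define R where "R = (\<Sum>i<n. monom (r $ i) i)"
  have cR: "coeff R i = (if i < n then r $ i else 0)" for i
    by (auto simp: R_def coeff_sum)
  define q where "q = monom 1 n - R"
  have cq: "coeff q n = 1" by (simp add: q_def cR)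
  have "degree q \<le> n"
    by (rule degree_le) (auto simp: q_def cR)
  then have dq: "degree q = n" using cq le_degree[of q n] by simp
  have ortho: "mom c (q * monom 1 k) = 0" if "k < n" for k
  proof -
    have "R * monom 1 k = (\<Sum>i<n. monom (r $ i) (i + k))"
      by (simp add: R_def sum_distrib_right mult_monom)
    then have "mom c (R * monom 1 k) = (\<Sum>j<n. c (k + j) * r $ j)"
      by (simp add: mom_sum mom_monom mult_ac add_ac)
    also have "\<dots> = c (n + k)" by (rule Hr[OF that])
    finally show ?thesis
      by (simp add: q_def left_diff_distrib mom_diff mult_monom mom_monom)
  qed
  have "mom c (q * g) = 0" if g: "degree g < n" for g
  proof -
    have "g = (\<Sum>i\<le>degree g. smult (coeff g i) (monom 1 i))"
      by (simp add: smult_monom poly_as_sum_of_monoms)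
    then have "q * g = (\<Sum>i\<le>degree g. smult (coeff g i) (q * monom 1 i))"
      by (metis (no_types, lifting) mult_smult_right sum.cong sum_distrib_left)
    then show ?thesis using g by (simp add: mom_sum mom_smult ortho)
  qed
  then show ?thesis using dq cq by auto
qed

text \<open>The remainder modulo the real quadratic with roots \<open>z\<close> and
  \<open>cnj z\<close> is linear and vanishes at the nonreal point \<open>z\<close>, which forces
  both of its coefficients to be zero.\<close>

lemma nonreal_root_imp_quadratic_dvd:
  fixes q :: "real poly"
  assumes "poly (map_poly complex_of_real q) z = 0" "Im z \<noteq> 0"
  shows "[:(Re z)\<^sup>2 + (Im z)\<^sup>2, - 2 * Re z, 1:] dvd q"
proof -
  define s where "s = [:(Re z)\<^sup>2 + (Im z)\<^sup>2, - 2 * Re z, 1:]"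
  have s0: "poly (map_poly complex_of_real s) z = 0"
    by (simp add: s_def map_poly_pCons complex_eq_iff power2_eq_square algebra_simps)
  define r where "r = q mod s"
  have "q = s * (q div s) + r" by (simp add: r_def)
  then have "poly (map_poly complex_of_real q) z
    = poly (map_poly complex_of_real s) z * poly (map_poly complex_of_real (q div s)) z
      + poly (map_poly complex_of_real r) z"
    by (metis map_poly_complex_of_real_add map_poly_complex_of_real_mult poly_add poly_mult)
  then have r0: "poly (map_poly complex_of_real r) z = 0" using assms(1) s0 by simp
  have "r = 0 \<or> degree r < degree s" unfolding r_def by (rule degree_mod_less) (simp add: s_def)
  then have "degree r \<le> 1" by (auto simp: s_def)
  then have "r = [:coeff r 0, coeff r 1:]"
    by (intro poly_eqI) (auto simp: coeff_pCons coeff_eq_0 split: nat.splits)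
  then obtain a b where ab: "r = [:a, b:]" by blast
  have "poly (map_poly complex_of_real [:a, b:]) z = of_real a + z * of_real b"
    by (simp add: map_poly_pCons)
  then have z: "of_real a + z * of_real b = 0" using r0 ab by metis
  have "Im z * b = 0" using arg_cong[OF z, of Im] by simp
  then have "b = 0" using assms(2) by simp
  moreover have "a + Re z * b = 0" using arg_cong[OF z, of Re] by simp
  ultimately have "a = 0" by simp
  have "r = 0" using ab \<open>a = 0\<close> \<open>b = 0\<close> by simp
  then show ?thesis by (simp add: r_def s_def mod_eq_0_iff_dvd)
qed

text \<open>A nonreal or a multiple root splits a quadratic factor off \<open>q\<close>. Multiplying
  \<open>q\<close> by the cofactor, of degree \<open>n - 2\<close>, gives a sum of squares with
  positive moment, against orthogonality.\<close>

lemma orthogonal_poly_real_simple_roots: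
  assumes pd: "posdef n c" and n: "degree q = n" "q \<noteq> 0"
    and ortho: "\<And>g. degree g < n \<Longrightarrow> mom c (q * g) = 0"
  shows "card {x. poly q x = 0} = n"
proof -
  define Q where "Q = map_poly complex_of_real q"
  have "coeff Q n \<noteq> 0" using n by (auto simp: Q_def coeff_map_poly)
  then have Q0: "Q \<noteq> 0" by auto
  have real: "Im z = 0" if z: "poly Q z = 0" for z
  proof (rule ccontr)
    assume im: "Im z \<noteq> 0"
    define s where "s = [:(Re z)\<^sup>2 + (Im z)\<^sup>2, - 2 * Re z, 1:]"
    have "s dvd q" unfolding s_def using z im by (intro nonreal_root_imp_quadratic_dvd) (auto simp: Q_def)
    then obtain g where g: "q = s * g" by blast
    have g0: "g \<noteq> 0" using n g by auto
    have "degree s = 2" by (simp add: s_def)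
    moreover have "s \<noteq> 0" by (simp add: s_def)
    ultimately have dg: "n = 2 + degree g" using n g g0 by (simp add: degree_mult_eq)
    define h where "h = [:- Re z, 1:] * g"
    have h: "h \<noteq> 0" "degree h < n"
      unfolding h_def using g0 dg by (auto simp: degree_mult_eq simp del: mult_pCons_left)
    define l where "l = [:- Re z, 1:]"
    \<comment> \<open>Completing the square turns \<open>q * g\<close> into a nonnegative
      combination of two squares.\<close>
    have "s = l * l + [:(Im z)\<^sup>2:]"
      by (simp add: s_def l_def power2_eq_square)
    then have "q * g = (l * g) * (l * g) + [:(Im z)\<^sup>2:] * (g * g)"
      unfolding g by (simp only: algebra_simps)
    then have "q * g = h\<^sup>2 + smult ((Im z)\<^sup>2) (g\<^sup>2)"
      by (simp add: h_def l_def[symmetric] power2_eq_square)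
    then have "mom c (q * g) = mom c (h\<^sup>2) + (Im z)\<^sup>2 * mom c (g\<^sup>2)"
      by (simp add: mom_add mom_smult)
    moreover have "mom c (h\<^sup>2) > 0" using pd h by (auto simp: posdef_def)
    moreover have "mom c (g\<^sup>2) > 0" using pd g0 dg by (auto simp: posdef_def)
    moreover have "(Im z)\<^sup>2 * mom c (g\<^sup>2) \<ge> 0" using \<open>mom c (g\<^sup>2) > 0\<close> by simp
    ultimately show False using ortho[of g] dg by linarith
  qed
  have "rsquarefree Q"
    unfolding rsquarefree_roots
  proof safe
    fix z assume z: "poly Q z = 0" "poly (pderiv Q) z = 0"
    define a where "a = Re z"
    have za: "z = of_real a" using real[OF z(1)] by (simp add: a_def complex_eq_iff)
    have "poly q a = 0" "poly (pderiv q) a = 0"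
      using z unfolding za Q_def pderiv_map_poly_complex_of_real poly_map_poly_complex_of_real by auto
    then obtain g where g: "q = [:- a, 1:] * g" using poly_eq_0_iff_dvd by blast
    then have "poly g a = 0" using \<open>poly (pderiv q) a = 0\<close>
      by (simp add: pderiv_mult pderiv_pCons del: mult_pCons_left)
    then obtain g' where g': "g = [:- a, 1:] * g'" using poly_eq_0_iff_dvd by blast
    have g0: "g' \<noteq> 0" using n g g' by auto
    \<comment> \<open>Splitting the double factor at \<open>a\<close> evenly makes
      \<open>q * g'\<close> the square of \<open>h\<close>.\<close>
    define h where "h = [:- a, 1:] * g'"
    have dg: "n = 2 + degree g'"
      using n(1) g0 unfolding g g' by (simp add: degree_mult_eq del: mult_pCons_left)
    have h: "h \<noteq> 0" "degree h < n"
      unfolding h_def using g0 dg by (auto simp: degree_mult_eq simp del: mult_pCons_left)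
    have "q * g' = h\<^sup>2" unfolding g g' h_def by (simp add: power2_eq_square mult_ac del: mult_pCons_left)
    then have "mom c (h\<^sup>2) = 0" using ortho[of g'] dg by simp
    then show False using pd h by (auto simp: posdef_def)
  qed
  then have "smult (lead_coeff Q) (\<Prod>z|poly Q z = 0. [:-z, 1:]) = Q"
    by (rule complex_poly_decompose_rsquarefree)
  then have "degree (\<Prod>z|poly Q z = 0. [:-z, 1:]) = degree Q"
    using Q0 by (metis degree_smult_eq leading_coeff_0_iff)
  moreover have "degree (\<Prod>z|poly Q z = 0. [:-z, 1:]) = card {z. poly Q z = 0}"
    by (subst degree_prod_sum_eq) auto
  ultimately have "card {z. poly Q z = 0} = n" using n by (simp add: Q_def)
  moreover have "{z. poly Q z = 0} = complex_of_real ` {x. poly q x = 0}"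
  proof (intro equalityI subsetI)
    fix z assume z: "z \<in> {z. poly Q z = 0}"
    then have "z = of_real (Re z)" using real by (simp add: complex_eq_iff)
    moreover then have "poly q (Re z) = 0"
      using z poly_map_poly_complex_of_real[of q "Re z"] by (simp add: Q_def)
    ultimately show "z \<in> complex_of_real ` {x. poly q x = 0}" by blast
  qed (auto simp: Q_def poly_map_poly_complex_of_real)
  ultimately show ?thesis by (simp add: card_image inj_on_def)
qed

text \<open>The nodes are the roots of the orthogonal polynomial. Each weight is the moment of a
  squared Lagrange polynomial, hence positive.\<close>

lemma gauss_quadrature:
  assumes pd: "posdef n c" and n: "n \<ge> 1"
  obtains x \<rho> where "inj_on x {1..n}" "\<And>k. k \<in> {1..n} \<Longrightarrow> \<rho> k > 0" "canonical_rep n c x \<rho>"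
proof -
  obtain q where q: "degree q = n" "lead_coeff q = 1" "\<And>g. degree g < n \<Longrightarrow> mom c (q * g) = 0"
    using posdef_orthogonal_poly[OF pd] by blast
  then have "q \<noteq> 0" by auto
  have card: "card {x. poly q x = 0} = n"
    using orthogonal_poly_real_simple_roots[OF pd q(1) \<open>q \<noteq> 0\<close> q(3)] .
  obtain x where x: "bij_betw x {1..n} {x. poly q x = 0}"
    using ex_bij_betw_nat_finite_1[OF poly_roots_finite[OF \<open>q \<noteq> 0\<close>]] card by auto
  then have inj: "inj_on x {1..n}" by (rule bij_betw_imp_inj_on)
  have root: "poly q (x k) = 0" if "k \<in> {1..n}" for k
    using bij_betwE[OF x] that by auto
  define L where "L = lagrange_poly x {1..n}"
  define \<rho> where "\<rho> k = mom c (L k)" for k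
  have quad: "mom c f = (\<Sum>k=1..n. \<rho> k * poly f (x k))" if f: "degree f \<le> 2 * n - 2" for f
  proof -
    \<comment> \<open>Orthogonality kills the multiple of \<open>q\<close>, whose cofactor has
      degree below \<open>n\<close>; the remainder agrees with \<open>f\<close> at the nodes and is
      interpolated exactly.\<close>
    define r where "r = f mod q"
    have f_eq: "f = q * (f div q) + r" by (simp add: r_def)
    have "r = 0 \<or> degree r < n" unfolding r_def using degree_mod_less[OF \<open>q \<noteq> 0\<close>, of f] q(1) by auto
    then have r: "degree r < n" using n by auto
    have "degree (f div q) < n"
    proof (cases "f div q = 0")
      case False
      then have "n + degree (f div q) = degree (q * (f div q))"
        using \<open>q \<noteq> 0\<close> q(1) by (simp add: degree_mult_eq)
      also have "\<dots> = degree (f - r)" using f_eq by (metis add_diff_cancel_right')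
      also have "\<dots> \<le> max (degree f) (degree r)" by (rule degree_diff_le_max)
      finally show ?thesis using f r by linarith
    qed (use n in simp)
    then have "mom c f = mom c r"
      using q(3) by (subst f_eq) (simp add: mom_add)
    also have "r = (\<Sum>k=1..n. smult (poly r (x k)) (L k))"
      unfolding L_def using inj r by (intro lagrange_interpolation[symmetric]) auto
    also have "mom c \<dots> = (\<Sum>k=1..n. \<rho> k * poly r (x k))"
      by (simp add: mom_sum mom_smult \<rho>_def mult_ac)
    also have "\<dots> = (\<Sum>k=1..n. \<rho> k * poly f (x k))"
    proof (rule sum.cong[OF refl])
      fix k assume "k \<in> {1..n}"
      then have "poly f (x k) = poly r (x k)" by (subst f_eq) (simp add: root)
      then show "\<rho> k * poly r (x k) = \<rho> k * poly f (x k)" by simp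
    qed
    finally show ?thesis .
  qed
  have "\<rho> k > 0" if k: "k \<in> {1..n}" for k
  proof -
    have deg: "degree (L k) < n" unfolding L_def using degree_lagrange_poly[of "{1..n}" k x] k by simp
    have val: "poly (L k) (x j) = (if j = k then 1 else 0)" if "j \<in> {1..n}" for j
      unfolding L_def using k that inj by (intro poly_lagrange_poly) auto
    have "L k \<noteq> 0" using val[OF k] by auto
    then have "0 < mom c ((L k)\<^sup>2)" using pd deg by (simp add: posdef_def)
    also have "\<dots> = (\<Sum>j=1..n. \<rho> j * poly ((L k)\<^sup>2) (x j))"
      by (rule quad) (rule degree_power2_less_le[OF deg])
    also have "\<dots> = (\<Sum>j=1..n. if j = k then \<rho> k else 0)"
      by (intro sum.cong) (auto simp: val)
    also have "\<dots> = \<rho> k" using k by simp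
    finally show ?thesis .
  qed
  moreover have "canonical_rep n c x \<rho>"
    unfolding canonical_rep_def
  proof safe
    fix k assume "k \<le> 2 * n - 2"
    then show "c k = (\<Sum>j=1..n. \<rho> j * x j ^ k)"
      using quad[of "monom 1 k"] by (simp add: degree_monom_eq mom_monom poly_monom)
  qed
  ultimately show ?thesis using inj that by blast
qed

section \<open>Equilibrium as a condition on logarithmic derivatives\<close>

text \<open>Conjugating the coefficients fixes the polynomial and exchanges the linear factors of
  \<open>z\<close> and \<open>cnj z\<close>; the resulting inequality of orders is used in both
  directions.\<close>

lemma order_cnj_map_poly_complex_of_real:
  assumes "p \<noteq> 0"
  shows "order (cnj z) (map_poly complex_of_real p) = order z (map_poly complex_of_real p)"
proof -
  define P where "P = map_poly complex_of_real p"
  have "coeff P (degree p) \<noteq> 0" using assms by (simp add: P_def coeff_map_poly)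
  then have P: "P \<noteq> 0" by auto
  have mult: "map_poly cnj (f * g) = map_poly cnj f * map_poly cnj g" for f g
    by (rule poly_eqI) (simp add: coeff_map_poly coeff_mult)
  have pow: "map_poly cnj ([:- z, 1:] ^ k) = [:- cnj z, 1:] ^ k" for z k
    by (induction k) (simp_all add: mult map_poly_pCons del: mult_pCons_left)
  have cP: "map_poly cnj P = P" by (rule poly_eqI) (simp add: P_def coeff_map_poly)
  have le: "order z P \<le> order (cnj z) P" for z
  proof -
    obtain g where "P = [:- z, 1:] ^ order z P * g" using order_1[of z P] by blast
    then have "P = [:- cnj z, 1:] ^ order z P * map_poly cnj g" by (metis cP mult pow)
    then have "[:- cnj z, 1:] ^ order z P dvd P" by (metis dvd_triv_left)
    then show ?thesis using P order_divides by blast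
  qed
  show ?thesis using le[of z] le[of "cnj z"] by (simp add: P_def)
qed

text \<open>In the absence of real zeros, the zeros are those enumerated by \<open>\<zeta>\<close>
  together with their conjugates, with equal multiplicities.\<close>

lemma upper_zeros_factorization:
  assumes uz: "upper_zeros p m \<zeta>" and noroot: "\<And>x. poly p x \<noteq> 0"
  shows "map_poly complex_of_real p
    = smult (lead_coeff (map_poly complex_of_real p)) (root_poly \<zeta> {1..m} * root_poly (cnj \<circ> \<zeta>) {1..m})"
proof -
  define P where "P = map_poly complex_of_real p"
  have "p \<noteq> 0" using noroot by auto
  then have "coeff P (degree p) \<noteq> 0" by (simp add: P_def coeff_map_poly)
  then have P: "P \<noteq> 0" by auto
  define U where "U = filter_mset (\<lambda>z. Im z > 0) (proots P)"
  have U: "U = image_mset \<zeta> (mset_set {1..m})"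
    using uz by (simp add: U_def P_def upper_zeros_def)
  have "proots P = U + image_mset cnj U"
  proof (rule multiset_eqI)
    fix z
    have c: "count (image_mset cnj U) z = count U (cnj z)"
    proof -
      have "{w \<in> set_mset U. z = cnj w} = (if cnj z \<in># U then {cnj z} else {})"
        by auto
      then show ?thesis by (simp add: count_image_mset' not_in_iff)
    qed
    have cU: "count U w = (if Im w > 0 then order w P else 0)" for w
      using P by (simp add: U_def)
    have "order z P = 0" if "Im z = 0"
    proof (rule order_0I)
      have "z = complex_of_real (Re z)" using that by (simp add: complex_eq_iff)
      then show "poly P z \<noteq> 0"
        using poly_map_poly_complex_of_real[of p "Re z"] noroot[of "Re z"] by (simp add: P_def)
    qed
    then show "count (proots P) z = count (U + image_mset cnj U) z"
      using P order_cnj_map_poly_complex_of_real[OF \<open>p \<noteq> 0\<close>, of z, folded P_def]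
      by (cases "Im z" "0 :: real" rule: linorder_cases) (auto simp: c cU)
  qed
  moreover have "(\<Prod>x\<in>#U. [:- x, 1:]) = root_poly \<zeta> {1..m}"
    by (simp add: U root_poly_def prod_unfold_prod_mset multiset.map_comp comp_def)
  moreover have "(\<Prod>x\<in>#image_mset cnj U. [:- x, 1:]) = root_poly (cnj \<circ> \<zeta>) {1..m}"
    by (simp add: U root_poly_def prod_unfold_prod_mset multiset.map_comp comp_def)
  ultimately have "(\<Prod>x\<in>#proots P. [:- x, 1:]) = root_poly \<zeta> {1..m} * root_poly (cnj \<circ> \<zeta>) {1..m}"
    by simp
  then show ?thesis using complex_poly_decompose_multiset[of P] by (simp add: P_def)
qed

lemma upper_zeros_logderiv:
  assumes uz: "upper_zeros p m \<zeta>" and noroot: "\<And>x. poly p x \<noteq> 0"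
  shows "(\<Sum>j=1..m. 1 / (complex_of_real x - \<zeta> j) + 1 / (complex_of_real x - cnj (\<zeta> j)))
    = complex_of_real (poly (pderiv p) x / poly p x)"
proof -
  define P where "P = map_poly complex_of_real p"
  define a where "a = lead_coeff P"
  define R1 where "R1 = root_poly \<zeta> {1..m}"
  define R2 where "R2 = root_poly (cnj \<circ> \<zeta>) {1..m}"
  define z where "z = complex_of_real x"
  have P: "P = smult a (R1 * R2)"
    using upper_zeros_factorization[OF uz noroot] by (simp add: P_def a_def R1_def R2_def)
  have val: "poly P z = complex_of_real (poly p x)" "poly (pderiv P) z = complex_of_real (poly (pderiv p) x)"
    by (auto simp: P_def z_def poly_map_poly_complex_of_real pderiv_map_poly_complex_of_real)
  have ne: "poly P z \<noteq> 0" using val noroot by simp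
  then have "poly R1 z \<noteq> 0" "poly R2 z \<noteq> 0" by (auto simp: P)
  then have out: "z \<notin> \<zeta> ` {1..m}" "z \<notin> (cnj \<circ> \<zeta>) ` {1..m}"
    unfolding R1_def R2_def by (auto simp: poly_root_poly_eq_0_iff)
  have d1: "poly (pderiv R1) z = poly R1 z * (\<Sum>j=1..m. 1 / (z - \<zeta> j))"
    unfolding R1_def by (rule logderiv_root_poly[OF _ out(1)]) simp
  have d2: "poly (pderiv R2) z = poly R2 z * (\<Sum>j=1..m. 1 / (z - (cnj \<circ> \<zeta>) j))"
    unfolding R2_def by (rule logderiv_root_poly[OF _ out(2)]) simp
  have "poly (pderiv P) z = poly P z * ((\<Sum>j=1..m. 1 / (z - \<zeta> j)) + (\<Sum>j=1..m. 1 / (z - cnj (\<zeta> j))))"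
    unfolding P pderiv_smult pderiv_mult by (simp add: d1 d2 algebra_simps)
  then have "(\<Sum>j=1..m. 1 / (z - \<zeta> j)) + (\<Sum>j=1..m. 1 / (z - cnj (\<zeta> j))) = poly (pderiv P) z / poly P z"
    using ne by simp
  also have "\<dots> = complex_of_real (poly (pderiv p) x / poly p x)" by (simp add: val)
  finally show ?thesis by (simp add: sum.distrib z_def)
qed

text \<open>The force of the fixed conjugate pairs is the real logarithmic derivative of
  \<open>p\<close>, so the complex equations become real ones comparable with
  \<open>deriv_lagrange_kernel\<close>.\<close>

lemma equilibrium_iff:
  assumes "upper_zeros p l \<zeta>" "\<And>x. poly p x \<noteq> 0"
  shows "equilibrium m l \<zeta> x \<longleftrightarrow> inj_on x {1..m} \<and>
    (\<forall>k\<in>{1..m}. 2 * (\<Sum>j\<in>{1..m} - {k}. 1 / (x k - x j)) = poly (pderiv p) (x k) / poly p (x k))"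
proof -
  have "(\<Sum>j\<in>{1..m} - {k}. 2 / (complex_of_real (x k) - complex_of_real (x j)))
    = complex_of_real (2 * (\<Sum>j\<in>{1..m} - {k}. 1 / (x k - x j)))" for k
    by (simp add: sum_distrib_left)
  then show ?thesis
    unfolding equilibrium_def upper_zeros_logderiv[OF assms] by (simp only: of_real_eq_iff right_minus_eq)
qed

section \<open>Existence of equilibria\<close>

text \<open>Brings the lower bound on \<open>p\<close> to a power of \<open>1 + x ^ 2\<close>, the
  weight against which differences of nodes are estimated.\<close>

lemma one_plus_square_power_le:
  "(1 + x\<^sup>2) ^ m \<le> 2 ^ m * (1 + x ^ (2 * m))" for x :: real
proof (cases "x\<^sup>2 \<le> 1")
  case True
  then have "(1 + x\<^sup>2) ^ m \<le> 2 ^ m" by (intro power_mono) auto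
  also have "\<dots> \<le> 2 ^ m * (1 + x ^ (2 * m))" by (simp add: power_mult)
  finally show ?thesis .
next
  case False
  then have "(1 + x\<^sup>2) ^ m \<le> (2 * x\<^sup>2) ^ m" by (intro power_mono) auto
  also have "\<dots> = 2 ^ m * x ^ (2 * m)" by (simp add: power_mult power_mult_distrib)
  finally show ?thesis by (simp add: algebra_simps add_increasing)
qed

text \<open>The product runs over ordered pairs, so each difference occurs twice and the index type
  needs no order. The numerator is the absolute value of the discriminant of the nodal
  polynomial.\<close>

definition vandermonde_ratio :: "real poly \<Rightarrow> 'i set \<Rightarrow> ('i \<Rightarrow> real) \<Rightarrow> real" where
  "vandermonde_ratio p A t = (\<Prod>k\<in>A. \<Prod>j\<in>A - {k}. \<bar>t k - t j\<bar>) / (\<Prod>k\<in>A. poly p (t k))"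

text \<open>
  Each node has degree \<open>2 * card A - 2\<close> in the numerator and \<open>2 * card A\<close> in the denominator, so the
  ratio vanishes at infinity.
\<close>

lemma vandermonde_ratio_bound:
  assumes fin: "finite A" and k: "k \<in> A" and d: "d > 0"
    and p: "\<And>x. poly p x \<ge> d * (1 + x\<^sup>2) ^ card A"
  shows "vandermonde_ratio p A t * (d ^ card A * (1 + (t k)\<^sup>2)) \<le> 1"
proof -
  define m where "m = card A"
  have m: "m > 0" using fin k by (auto simp: m_def card_gt_0_iff)
  define W where "W i = 1 + (t i)\<^sup>2" for i
  define Z where "Z = (\<Prod>i\<in>A. W i)"
  have W1: "W i \<ge> 1" and W0: "W i > 0" for i by (auto simp: W_def add_pos_nonneg)
  have Z0: "Z > 0" unfolding Z_def using W0 by (intro prod_pos) auto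
  define V where "V = (\<Prod>k\<in>A. \<Prod>j\<in>A - {k}. \<bar>t k - t j\<bar>)"
  have V0: "V \<ge> 0" unfolding V_def by (intro prod_nonneg) auto
  have "V\<^sup>2 = (\<Prod>k\<in>A. \<Prod>j\<in>A - {k}. (t k - t j)\<^sup>2)"
    unfolding V_def by (simp add: prod_power_distrib)
  also have "\<dots> \<le> (\<Prod>k\<in>A. \<Prod>j\<in>A - {k}. W k * W j)"
  proof (intro prod_mono conjI prod_nonneg)
    fix i j
    \<comment> \<open>The two-square identity bounds each difference by the weights of its two
      nodes.\<close>
    have "W i * W j - (t i - t j)\<^sup>2 = (1 + t i * t j)\<^sup>2"
      by (simp add: W_def power2_eq_square algebra_simps)
    then show "(t i - t j)\<^sup>2 \<le> W i * W j" using zero_le_power2[of "1 + t i * t j"] by linarith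
  qed auto
  \<comment> \<open>Each weight occurs \<open>m - 1\<close> times as the first and
    \<open>m - 1\<close> times as the second member of an ordered pair.\<close>
  also have "\<dots> = (\<Prod>k\<in>A. W k ^ (m - 1) * (Z / W k))"
  proof (rule prod.cong[OF refl])
    fix i assume i: "i \<in> A"
    have "Z = W i * (\<Prod>j\<in>A - {i}. W j)" unfolding Z_def using fin i by (simp add: prod.remove)
    then have "(\<Prod>j\<in>A - {i}. W j) = Z / W i" using W0[of i] by (simp add: field_simps)
    then show "(\<Prod>j\<in>A - {i}. W i * W j) = W i ^ (m - 1) * (Z / W i)"
      using i fin by (simp add: prod.distrib m_def)
  qed
  also have "\<dots> = Z ^ (m - 1) * (Z ^ m / Z)"
    by (simp add: prod.distrib prod_dividef Z_def m_def prod_power_distrib)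
  also have "Z ^ m / Z = Z ^ (m - 1)" using Z0 m by (cases m) auto
  finally have "V\<^sup>2 \<le> (Z ^ (m - 1))\<^sup>2" by (simp add: power2_eq_square)
  then have V_le: "V \<le> Z ^ (m - 1)" using Z0 by (intro power2_le_imp_le[of V]) auto
  define D where "D = (\<Prod>i\<in>A. poly p (t i))"
  have "d ^ m * Z ^ m = (\<Prod>i\<in>A. d * W i ^ m)"
    by (simp add: prod.distrib Z_def m_def prod_power_distrib)
  also have "\<dots> \<le> D"
    unfolding D_def using p d W0 by (intro prod_mono) (auto simp: W_def m_def intro!: mult_nonneg_nonneg add_nonneg_nonneg)
  finally have D_ge: "d ^ m * Z ^ m \<le> D" .
  have "0 < d ^ m * Z ^ m" using d Z0 by simp
  then have D0: "D > 0" using D_ge by linarith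
  have "Z = W k * (\<Prod>j\<in>A - {k}. W j)" unfolding Z_def using fin k by (simp add: prod.remove)
  moreover have "(\<Prod>j\<in>A - {k}. W j) \<ge> 1" using W1 by (intro prod_ge_1) auto
  ultimately have WZ: "W k \<le> Z" using W0[of k] by (simp add: mult_le_cancel_left1)
  \<comment> \<open>The numerator is one factor \<open>Z\<close> short of the bound for the
    denominator, which leaves room for \<open>W k\<close>.\<close>
  have "V * (d ^ m * W k) \<le> Z ^ (m - 1) * (d ^ m * Z)"
    using V_le WZ d Z0 W0[of k] by (intro mult_mono) auto
  also have "\<dots> = d ^ m * Z ^ m" using m by (cases m) auto
  finally have "V * (d ^ m * W k) \<le> D" using D_ge by linarith
  then have "V * (d ^ m * W k) / D \<le> 1" using D0 by simp
  then show ?thesis by (simp add: vandermonde_ratio_def V_def D_def W_def m_def)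
qed

text \<open>Isolates the dependence on a single node, so that stationarity becomes a problem in one
  real variable.\<close>

lemma vandermonde_ratio_update:
  assumes fin: "finite A" and k: "k \<in> A"
  shows "vandermonde_ratio p A (t(k := s)) = vandermonde_ratio p (A - {k}) t *
    ((poly (root_poly t (A - {k})) s)\<^sup>2 / poly p s)"
proof -
  define B where "B = A - {k}"
  define u where "u = t(k := s)"
  have u: "u k = s" "\<And>j. j \<in> B \<Longrightarrow> u j = t j" by (auto simp: u_def B_def)
  have B: "finite B" "k \<notin> B" "A = insert k B" using fin k by (auto simp: B_def)
  have "(\<Prod>i\<in>A. \<Prod>j\<in>A - {i}. \<bar>u i - u j\<bar>)
    = (\<Prod>j\<in>B. \<bar>u k - u j\<bar>) * (\<Prod>i\<in>B. \<Prod>j\<in>A - {i}. \<bar>u i - u j\<bar>)"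
    using fin k by (simp add: prod.remove[of A k] B_def)
  also have "(\<Prod>j\<in>B. \<bar>u k - u j\<bar>) = (\<Prod>j\<in>B. \<bar>s - t j\<bar>)"
    by (intro prod.cong) (auto simp: u)
  also have "(\<Prod>i\<in>B. \<Prod>j\<in>A - {i}. \<bar>u i - u j\<bar>)
    = (\<Prod>i\<in>B. \<bar>s - t i\<bar> * (\<Prod>j\<in>B - {i}. \<bar>t i - t j\<bar>))"
  proof (rule prod.cong[OF refl])
    fix i assume i: "i \<in> B"
    then have "A - {i} = insert k (B - {i})" "k \<notin> B - {i}" using B(2,3) by auto
    then have "(\<Prod>j\<in>A - {i}. \<bar>u i - u j\<bar>) = \<bar>u i - u k\<bar> * (\<Prod>j\<in>B - {i}. \<bar>u i - u j\<bar>)"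
      using B(1) by simp
    also have "(\<Prod>j\<in>B - {i}. \<bar>u i - u j\<bar>) = (\<Prod>j\<in>B - {i}. \<bar>t i - t j\<bar>)"
      using i by (intro prod.cong) (auto simp: u)
    finally show "(\<Prod>j\<in>A - {i}. \<bar>u i - u j\<bar>) = \<bar>s - t i\<bar> * (\<Prod>j\<in>B - {i}. \<bar>t i - t j\<bar>)"
      using i by (simp add: u abs_minus_commute)
  qed
  finally have "(\<Prod>i\<in>A. \<Prod>j\<in>A - {i}. \<bar>u i - u j\<bar>)
    = (\<Prod>j\<in>B. \<bar>s - t j\<bar>)\<^sup>2 * (\<Prod>i\<in>B. \<Prod>j\<in>B - {i}. \<bar>t i - t j\<bar>)"
    by (simp add: prod.distrib power2_eq_square)
  moreover have "(\<Prod>j\<in>B. \<bar>s - t j\<bar>)\<^sup>2 = (poly (root_poly t B) s)\<^sup>2"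
    by (simp add: poly_root_poly abs_prod[symmetric])
  moreover have "(\<Prod>i\<in>A. poly p (u i)) = poly p s * (\<Prod>i\<in>B. poly p (t i))"
    using fin k by (simp add: prod.remove[of A k] B_def[symmetric] u cong: prod.cong)
  ultimately show ?thesis
    by (simp add: vandermonde_ratio_def u_def B_def[symmetric] mult_ac)
qed

lemma stationary_square_ratio:
  fixes w p :: "real poly"
  assumes max: "\<And>s. (poly w s)\<^sup>2 / poly p s \<le> (poly w a)\<^sup>2 / poly p a"
    and ne: "poly w a \<noteq> 0" "poly p a \<noteq> 0"
  shows "2 * poly (pderiv w) a * poly p a = poly w a * poly (pderiv p) a"
proof -
  have "((\<lambda>s. (poly w s)\<^sup>2 / poly p s) has_real_derivative
      ((2 * poly w a * poly (pderiv w) a) * poly p a - (poly w a)\<^sup>2 * poly (pderiv p) a) / (poly p a * poly p a)) (at a)"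
    using ne by (auto intro!: derivative_eq_intros simp: power2_eq_square)
  then have "((2 * poly w a * poly (pderiv w) a) * poly p a - (poly w a)\<^sup>2 * poly (pderiv p) a) / (poly p a * poly p a) = 0"
    by (rule DERIV_local_max[where d = 1]) (use max in auto)
  then have "poly w a * (2 * poly (pderiv w) a * poly p a - poly w a * poly (pderiv p) a) = 0"
    using ne by (simp add: power2_eq_square algebra_simps)
  then show ?thesis using ne by simp
qed

text \<open>A maximiser over a large cube is also maximal against moving any one node along the
  whole line, so every partial derivative of the ratio vanishes.\<close>

lemma exists_stationary_points:
  fixes p :: "real poly" and A :: "nat set"
  assumes fin: "finite A" and e: "e > 0" and p: "\<And>x. poly p x \<ge> e * (1 + x ^ (2 * card A))"
  shows "\<exists>t. inj_on t A \<and>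
    (\<forall>k\<in>A. 2 * (\<Sum>j\<in>A - {k}. 1 / (t k - t j)) = poly (pderiv p) (t k) / poly p (t k))"
proof -
  define m where "m = card A"
  define d where "d = e / 2 ^ m"
  have d: "d > 0" using e by (simp add: d_def)
  have pd: "poly p x \<ge> d * (1 + x\<^sup>2) ^ m" for x
  proof -
    have "d * (1 + x\<^sup>2) ^ m \<le> d * (2 ^ m * (1 + x ^ (2 * m)))"
      using d one_plus_square_power_le by (intro mult_left_mono) auto
    also have "\<dots> = e * (1 + x ^ (2 * m))" by (simp add: d_def)
    finally show ?thesis using p[of x] by (simp add: m_def)
  qed
  have p0: "poly p x > 0" for x
  proof -
    have "0 < d * (1 + x\<^sup>2) ^ m" using d by (intro mult_pos_pos zero_less_power add_pos_nonneg) auto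
    then show ?thesis using pd[of x] by linarith
  qed
  define F where "F = vandermonde_ratio p A"
  have bound: "F t * (d ^ m * (1 + (t k)\<^sup>2)) \<le> 1" if "k \<in> A" for t k
    unfolding F_def m_def using that fin d pd by (intro vandermonde_ratio_bound) (auto simp: m_def)
  \<comment> \<open>Any configuration with distinct nodes would serve as reference; its ratio is
    positive.\<close>
  define t0 where "t0 i = (if i \<in> A then real i else 0)" for i
  have F0: "F t0 > 0"
    unfolding F_def vandermonde_ratio_def using p0
    by (intro divide_pos_pos prod_pos) (auto simp: t0_def)
  \<comment> \<open>Large enough for the cube to contain \<open>t0\<close>, and for
    \<open>vandermonde_ratio_bound\<close> to rule out a ratio above \<open>F t0\<close> once some
    node has absolute value above \<open>R\<close>.\<close>
  define R where "R = Max (insert (1 / (d ^ m * F t0)) (real ` A))"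
  have R1: "1 / (d ^ m * F t0) \<le> R" unfolding R_def using fin by (intro Max_ge) auto
  have RA: "real i \<le> R" if "i \<in> A" for i unfolding R_def using fin that by (intro Max_ge) auto
  have "0 < 1 / (d ^ m * F t0)" using d F0 by simp
  then have R0: "R > 0" using R1 by linarith
  \<comment> \<open>Coordinates outside \<open>A\<close> are frozen at 0, which makes the cube a
    compact product in the function space.\<close>
  define K where "K = PiE UNIV (\<lambda>i. if i \<in> A then {-R..R} else {0 :: real})"
  have "compactin (product_topology (\<lambda>i::nat. euclidean) UNIV) K"
    unfolding K_def compactin_PiE by auto
  then have cK: "compact K" by (simp add: euclidean_product_topology)
  have t0K: "t0 \<in> K" using RA R0 by (auto simp: K_def t0_def intro: order.trans[of _ 0])
  have "continuous_on K F"
    unfolding F_def vandermonde_ratio_def using p0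
    by (intro continuous_intros continuous_on_subset[OF continuous_on_product_coordinates])
       (auto simp: fin less_imp_neq[symmetric])
  then obtain t where t: "t \<in> K" "\<And>u. u \<in> K \<Longrightarrow> F u \<le> F t"
    using continuous_attains_sup[OF cK] t0K by blast
  have Ft: "F t0 \<le> F t" using t(2)[OF t0K] .
  \<comment> \<open>A collision would make the ratio zero, below its value at
    \<open>t0\<close>.\<close>
  have inj: "inj_on t A"
  proof (rule inj_onI, rule ccontr)
    fix a b assume ab: "a \<in> A" "b \<in> A" "t a = t b" "a \<noteq> b"
    then have "(\<Prod>j\<in>A - {a}. \<bar>t a - t j\<bar>) = 0" using fin by (auto intro!: bexI[of _ b])
    then have "F t = 0" using ab fin by (auto simp: F_def vandermonde_ratio_def)
    then show False using Ft F0 by simp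
  qed
  have max: "F (t(k := s)) \<le> F t" if k: "k \<in> A" for k s
  proof (cases "\<bar>s\<bar> \<le> R")
    case True
    have ti: "t i \<in> (if i \<in> A then {-R..R} else {0})" for i
      using t(1) unfolding K_def by (rule PiE_mem) simp
    have "(t(k := s)) i \<in> (if i \<in> A then {-R..R} else {0})" for i
      using ti[of i] k True by (cases "i = k") (auto simp: abs_le_iff)
    then have "t(k := s) \<in> K" unfolding K_def PiE_UNIV_domain by blast
    then show ?thesis by (rule t(2))
  next
    case False
    let ?u = "t(k := s)"
    have "R\<^sup>2 \<le> s\<^sup>2" using False R0 by (simp add: abs_le_square_iff[symmetric])
    show ?thesis
    proof (rule ccontr)
      assume "\<not> ?thesis"
      then have "F t0 < F ?u" using Ft by simp
      have "1 \<le> R * (d ^ m * F t0)" using R1 d F0 by (simp add: field_simps)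
      also have "\<dots> < (1 + R\<^sup>2) * (d ^ m * F t0)"
      proof (rule mult_strict_right_mono)
        have "0 \<le> (R - 1)\<^sup>2" by simp
        then show "R < 1 + R\<^sup>2" using R0 unfolding power2_diff by simp
      qed (use d F0 in simp)
      also have "\<dots> \<le> (1 + s\<^sup>2) * (d ^ m * F ?u)"
        using \<open>R\<^sup>2 \<le> s\<^sup>2\<close> \<open>F t0 < F ?u\<close> d F0 by (intro mult_mono) auto
      also have "\<dots> \<le> 1" using bound[OF k, of ?u] by (simp add: mult_ac)
      finally show False by simp
    qed
  qed
  have "2 * (\<Sum>j\<in>A - {k}. 1 / (t k - t j)) = poly (pderiv p) (t k) / poly p (t k)" if k: "k \<in> A" for k
  proof -
    define w where "w = root_poly t (A - {k})"
    define C where "C = vandermonde_ratio p (A - {k}) t"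
    have Fk: "F (t(k := s)) = C * ((poly w s)\<^sup>2 / poly p s)" for s
      unfolding F_def C_def w_def by (rule vandermonde_ratio_update[OF fin k])
    have "C > 0"
      unfolding C_def vandermonde_ratio_def using p0 inj
      by (intro divide_pos_pos prod_pos) (auto simp: inj_on_def)
    have out: "t k \<notin> t ` (A - {k})" using inj k by (auto simp: inj_on_def)
    have "2 * poly (pderiv w) (t k) * poly p (t k) = poly w (t k) * poly (pderiv p) (t k)"
    proof (rule stationary_square_ratio)
      show "(poly w s)\<^sup>2 / poly p s \<le> (poly w (t k))\<^sup>2 / poly p (t k)" for s
      proof -
        have "F t = C * ((poly w (t k))\<^sup>2 / poly p (t k))" using Fk[of "t k"] by (simp only: fun_upd_triv)
        then show ?thesis using max[OF k, of s] \<open>C > 0\<close> unfolding Fk by (metis mult_le_cancel_left_pos)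
      qed
      show "poly w (t k) \<noteq> 0" using out fin by (simp add: w_def poly_root_poly_eq_0_iff)
      show "poly p (t k) \<noteq> 0" using p0[of "t k"] by simp
    qed
    moreover have "poly (pderiv w) (t k) = poly w (t k) * (\<Sum>j\<in>A - {k}. 1 / (t k - t j))"
      unfolding w_def using fin out by (intro logderiv_root_poly) auto
    moreover have "poly w (t k) \<noteq> 0" using out fin by (simp add: w_def poly_root_poly_eq_0_iff)
    ultimately show ?thesis using p0[of "t k"] by (simp add: field_simps)
  qed
  then show ?thesis using inj by blast
qed

section \<open>Kernels of canonical representations\<close>

lemma degree_lagrange_kernel:
  "degree (\<Sum>k=1..m. smult (w k) ((lagrange_poly x {1..m} k)\<^sup>2)) \<le> 2 * m - 2"
proof (rule degree_sum_le)
  fix k assume k: "k \<in> {1..m}"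
  have "degree (lagrange_poly x {1..m} k) < m" using degree_lagrange_poly[of "{1..m}" k x] k by simp
  then have "degree ((lagrange_poly x {1..m} k)\<^sup>2) \<le> 2 * m - 2" by (rule degree_power2_less_le)
  then show "degree (smult (w k) ((lagrange_poly x {1..m} k)\<^sup>2)) \<le> 2 * m - 2"
    using degree_smult_le order.trans by blast
qed simp

text \<open>Both sides agree to second order at \<open>n\<close> nodes, while their difference has
  degree at most \<open>2 * n - 2\<close>.\<close>

lemma lagrange_kernel_eqI:
  assumes inj: "inj_on x {1..n}" and n: "n \<ge> 1" and deg: "degree p \<le> 2 * n - 2"
    and p: "\<And>x. poly p x \<noteq> 0"
    and eq: "\<And>k. k \<in> {1..n} \<Longrightarrow>
      2 * (\<Sum>j\<in>{1..n} - {k}. 1 / (x k - x j)) = poly (pderiv p) (x k) / poly p (x k)"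
  shows "(\<Sum>k=1..n. smult (poly p (x k)) ((lagrange_poly x {1..n} k)\<^sup>2)) = p" (is "?K = p")
proof -
  have "?K - p = 0"
  proof (rule poly_eq_0_double_roots[OF _ inj])
    have "degree (?K - p) \<le> 2 * n - 2"
      by (intro degree_diff_le degree_lagrange_kernel deg)
    then show "degree (?K - p) < 2 * card {1..n}" using n by simp
  next
    fix k assume k: "k \<in> {1..n}"
    note K = deriv_lagrange_kernel[OF finite_atLeastAtMost inj k, of "\<lambda>k. poly p (x k)"]
    show "poly (?K - p) (x k) = 0" unfolding poly_diff K(1) by simp
    show "poly (pderiv (?K - p)) (x k) = 0"
      unfolding pderiv_diff poly_diff K(2) using eq[OF k] p[of "x k"] by (simp add: field_simps)
  qed simp
  then show ?thesis by simp
qed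

text \<open>The squared nodal polynomial has double zeros at all nodes, so it leaves values and
  derivatives there unchanged and only contributes the leading coefficient.\<close>

lemma lagrange_kernel_inf:
  fixes w :: "nat \<Rightarrow> real" and a :: real
  defines "K \<equiv> \<lambda>t m. (\<Sum>k=1..m. smult (w k) ((lagrange_poly t {1..m} k)\<^sup>2)) + smult a ((root_poly t {1..m})\<^sup>2)"
  assumes inj: "inj_on t {1..m}"
  shows "degree (K t m) \<le> 2 * m" and "m \<ge> 1 \<Longrightarrow> coeff (K t m) (2 * m) = a"
    and "k \<in> {1..m} \<Longrightarrow> poly (K t m) (t k) = w k"
    and "k \<in> {1..m} \<Longrightarrow> poly (pderiv (K t m)) (t k) = 2 * w k * (\<Sum>j\<in>{1..m} - {k}. 1 / (t k - t j))"
proof -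
  define S where "S = (\<Sum>k=1..m. smult (w k) ((lagrange_poly t {1..m} k)\<^sup>2))"
  define W where "W = root_poly t {1..m}"
  have K: "K t m = S + smult a (W\<^sup>2)" by (simp add: K_def S_def W_def)
  have dW: "degree W = m" by (simp add: W_def degree_root_poly)
  have dS: "degree S \<le> 2 * m - 2" unfolding S_def by (rule degree_lagrange_kernel)
  have "degree (smult a (W\<^sup>2)) \<le> 2 * m"
    using dW degree_power_le[of W 2] degree_smult_le[of a "W\<^sup>2"] by simp
  then show "degree (K t m) \<le> 2 * m" unfolding K using dS by (intro degree_add_le) auto
  have "coeff (W * W) (degree W + degree W) = 1"
    unfolding coeff_mult_degree_sum using monic_root_poly[of t "{1..m}"] by (simp add: W_def degree_root_poly)
  then have cW: "coeff (W\<^sup>2) (2 * m) = 1" by (simp add: dW power2_eq_square mult_2)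
  show "coeff (K t m) (2 * m) = a" if "m \<ge> 1"
  proof -
    have "coeff S (2 * m) = 0" using dS that by (intro coeff_eq_0) simp
    then show ?thesis by (simp add: K cW)
  qed
  assume k: "k \<in> {1..m}"
  have W0: "poly W (t k) = 0" using k by (simp add: W_def poly_root_poly_eq_0_iff)
  note D = deriv_lagrange_kernel[OF finite_atLeastAtMost inj k, of w, folded S_def]
  show "poly (K t m) (t k) = w k" by (simp add: K D W0)
  show "poly (pderiv (K t m)) (t k) = 2 * w k * (\<Sum>j\<in>{1..m} - {k}. 1 / (t k - t j))"
    unfolding K pderiv_add poly_add D(2)
    by (simp add: pderiv_smult pderiv_mult power2_eq_square W0)
qed

text \<open>Degree \<open>2 * m\<close> is one too large for \<open>m\<close> double roots; matching
  the coefficient of that order removes the excess.\<close>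

lemma lagrange_kernel_inf_eqI:
  assumes inj: "inj_on t {1..m}" and m: "m \<ge> 1" and deg: "degree p \<le> 2 * m"
    and p: "\<And>x. poly p x \<noteq> 0"
    and eq: "\<And>k. k \<in> {1..m} \<Longrightarrow>
      2 * (\<Sum>j\<in>{1..m} - {k}. 1 / (t k - t j)) = poly (pderiv p) (t k) / poly p (t k)"
  shows "(\<Sum>k=1..m. smult (poly p (t k)) ((lagrange_poly t {1..m} k)\<^sup>2))
    + smult (coeff p (2 * m)) ((root_poly t {1..m})\<^sup>2) = p" (is "?K = p")
proof -
  note K = lagrange_kernel_inf[OF inj, where w = "\<lambda>k. poly p (t k)" and a = "coeff p (2 * m)"]
  have "?K - p = 0"
  proof (rule poly_eq_0_double_roots[OF _ inj])
    have "degree (?K - p) \<le> 2 * m" using K(1) deg by (rule degree_diff_le)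
    moreover have "coeff (?K - p) (2 * m) = 0" unfolding coeff_diff K(2)[OF m] by simp
    ultimately have "degree (?K - p) < 2 * m"
      using m eq_zero_or_degree_less[of "?K - p" "2 * m"] by auto
    then show "degree (?K - p) < 2 * card {1..m}" by simp
  next
    fix k assume k: "k \<in> {1..m}"
    show "poly (?K - p) (t k) = 0" unfolding poly_diff K(3)[OF k] by simp
    show "poly (pderiv (?K - p)) (t k) = 0"
      unfolding pderiv_diff poly_diff K(4)[OF k] using eq[OF k] p[of "t k"] by (simp add: field_simps)
  qed simp
  then show ?thesis by simp
qed

text \<open>
  With nodes \<open>x\<close>, \<open>y\<close> and Lagrange bases \<open>L\<close>, \<open>M\<close> of the two quadratures, \<open>D k l\<close> below is the difference
  of the moments of \<open>L k * M l\<close>. In matrix terms, its weighted sum of squares is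
  \<open>tr ((H(c) - H(d)) (H(d)\<^sup>-\<^sup>1 - H(c)\<^sup>-\<^sup>1))\<close>.
\<close>

lemma nesterov_unique_moments:
  assumes x: "canonical_rep n c x \<rho>" "inj_on x {1..n}" "\<And>k. k \<in> {1..n} \<Longrightarrow> \<rho> k > 0"
    and y: "canonical_rep n d y \<tau>" "inj_on y {1..n}" "\<And>k. k \<in> {1..n} \<Longrightarrow> \<tau> k > 0"
    and eq: "nesterov n c = nesterov n d"
    and fg: "degree f < n" "degree g < n"
  shows "mom c (f * g) = mom d (f * g)"
proof -
  define A where "A = {1..n}"
  define L where "L = lagrange_poly x A"
  define M where "M = lagrange_poly y A"
  have fin: "finite A" "card A = n" by (auto simp: A_def)
  have inj: "inj_on x A" "inj_on y A" using x(2) y(2) by (auto simp: A_def)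
  have pos: "\<rho> k > 0" "\<tau> k > 0" if "k \<in> A" for k using x(3) y(3) that by (auto simp: A_def)
  have deg: "degree (L k) < n" "degree (M k) < n" if "k \<in> A" for k
    using that degree_lagrange_poly[OF fin(1)] fin(2) by (auto simp: L_def M_def)
  have K: "(\<Sum>k\<in>A. smult (1 / \<rho> k) ((L k)\<^sup>2)) = (\<Sum>k\<in>A. smult (1 / \<tau> k) ((M k)\<^sup>2))"
    using nesterov_canonical_rep[OF x] nesterov_canonical_rep[OF y] eq
    by (simp add: coeff_inject L_def M_def A_def)
  \<comment> \<open>Written in the basis \<open>M\<close> and evaluated at \<open>x k\<close>, the
    common kernel still has the value \<open>1 / \<rho> k\<close>.\<close>
  have Kx: "(\<Sum>l\<in>A. (poly (M l) (x k))\<^sup>2 / \<tau> l) = 1 / \<rho> k" if "k \<in> A" for k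
    using deriv_lagrange_kernel(1)[OF fin(1) inj(1) that, of "\<lambda>k. 1 / \<rho> k", folded L_def]
    unfolding K by (simp add: poly_sum)
  have Ky: "(\<Sum>k\<in>A. (poly (L k) (y l))\<^sup>2 / \<rho> k) = 1 / \<tau> l" if "l \<in> A" for l
    using deriv_lagrange_kernel(1)[OF fin(1) inj(2) that, of "\<lambda>k. 1 / \<tau> k", folded M_def]
    unfolding K[symmetric] by (simp add: poly_sum)
  \<comment> \<open>Expansion of \<open>L k\<close> in the basis \<open>M\<close>, evaluated at
    \<open>x k\<close>; summation over \<open>k\<close> yields the cross term.\<close>
  have interp: "(\<Sum>l\<in>A. poly (L k) (y l) * poly (M l) (x k)) = 1" if "k \<in> A" for k
  proof -
    have "(\<Sum>l\<in>A. smult (poly (L k) (y l)) (M l)) = L k"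
      unfolding M_def by (rule lagrange_interpolation[OF fin(1) inj(2)]) (use deg that fin in simp)
    then have "poly (\<Sum>l\<in>A. smult (poly (L k) (y l)) (M l)) (x k) = poly (L k) (x k)" by simp
    also have "\<dots> = 1" unfolding L_def using that fin inj by (simp add: poly_lagrange_poly)
    finally show ?thesis by (simp add: poly_sum)
  qed
  define D where "D k l = \<rho> k * poly (M l) (x k) - \<tau> l * poly (L k) (y l)" for k l
  have "(D k l)\<^sup>2 / (\<rho> k * \<tau> l) = \<rho> k * ((poly (M l) (x k))\<^sup>2 / \<tau> l)
      - 2 * (poly (L k) (y l) * poly (M l) (x k)) + \<tau> l * ((poly (L k) (y l))\<^sup>2 / \<rho> k)"
    if "k \<in> A" "l \<in> A" for k l
    using pos(1)[OF that(1)] pos(2)[OF that(2)] by (simp add: D_def power2_eq_square field_simps)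
  then have "(\<Sum>k\<in>A. \<Sum>l\<in>A. (D k l)\<^sup>2 / (\<rho> k * \<tau> l))
    = (\<Sum>k\<in>A. \<Sum>l\<in>A. \<rho> k * ((poly (M l) (x k))\<^sup>2 / \<tau> l)
      - 2 * (poly (L k) (y l) * poly (M l) (x k)) + \<tau> l * ((poly (L k) (y l))\<^sup>2 / \<rho> k))"
    by (intro sum.cong) auto
  also have "\<dots> = (\<Sum>k\<in>A. \<rho> k * (\<Sum>l\<in>A. (poly (M l) (x k))\<^sup>2 / \<tau> l))
      - 2 * (\<Sum>k\<in>A. \<Sum>l\<in>A. poly (L k) (y l) * poly (M l) (x k))
      + (\<Sum>k\<in>A. \<Sum>l\<in>A. \<tau> l * ((poly (L k) (y l))\<^sup>2 / \<rho> k))"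
    by (simp only: sum.distrib sum_subtractf sum_distrib_left)
  also have "(\<Sum>k\<in>A. \<Sum>l\<in>A. \<tau> l * ((poly (L k) (y l))\<^sup>2 / \<rho> k))
    = (\<Sum>l\<in>A. \<tau> l * (\<Sum>k\<in>A. (poly (L k) (y l))\<^sup>2 / \<rho> k))"
    by (subst sum.swap) (simp only: sum_distrib_left)
  also have "(\<Sum>l\<in>A. \<tau> l * (\<Sum>k\<in>A. (poly (L k) (y l))\<^sup>2 / \<rho> k)) = (\<Sum>l\<in>A. 1)"
    by (rule sum.cong[OF refl]) (use Ky pos(2) in \<open>simp add: less_imp_neq[symmetric]\<close>)
  also have "(\<Sum>k\<in>A. \<rho> k * (\<Sum>l\<in>A. (poly (M l) (x k))\<^sup>2 / \<tau> l)) = (\<Sum>l\<in>A. 1)"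
    by (rule sum.cong[OF refl]) (use Kx pos(1) in \<open>simp add: less_imp_neq[symmetric]\<close>)
  also have "(\<Sum>k\<in>A. \<Sum>l\<in>A. poly (L k) (y l) * poly (M l) (x k)) = (\<Sum>k\<in>A. 1)"
    by (rule sum.cong[OF refl interp])
  finally have sum0: "(\<Sum>k\<in>A. \<Sum>l\<in>A. (D k l)\<^sup>2 / (\<rho> k * \<tau> l)) = 0" by simp
  have nonneg: "(D k l)\<^sup>2 / (\<rho> k * \<tau> l) \<ge> 0" if "k \<in> A" "l \<in> A" for k l
    using pos(1)[OF that(1)] pos(2)[OF that(2)] by simp
  have D0: "D k l = 0" if kl: "k \<in> A" "l \<in> A" for k l
  proof -
    have "(\<Sum>l\<in>A. (D k l)\<^sup>2 / (\<rho> k * \<tau> l)) = 0"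
      using sum0 kl nonneg by (subst (asm) sum_nonneg_eq_0_iff) (auto intro!: sum_nonneg simp: fin)
    then have "(D k l)\<^sup>2 / (\<rho> k * \<tau> l) = 0"
      using kl nonneg by (subst (asm) sum_nonneg_eq_0_iff) (auto simp: fin)
    then show ?thesis using pos(1)[OF kl(1)] pos(2)[OF kl(2)] by simp
  qed
  have LM: "mom c (L k * M l) = mom d (L k * M l)" if kl: "k \<in> A" "l \<in> A" for k l
  proof -
    have dKL: "degree (L k * M l) \<le> 2 * n - 2"
      using deg kl by (intro degree_mult_less_le) auto
    have "mom c (L k * M l) = (\<Sum>j\<in>A. if j = k then \<rho> k * poly (M l) (x k) else 0)"
      unfolding mom_canonical_rep[OF x(1) dKL] A_def[symmetric]
      using kl fin inj by (intro sum.cong) (auto simp: L_def poly_lagrange_poly)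
    moreover have "mom d (L k * M l) = (\<Sum>j\<in>A. if j = l then \<tau> l * poly (L k) (y l) else 0)"
      unfolding mom_canonical_rep[OF y(1) dKL] A_def[symmetric]
      using kl fin inj by (intro sum.cong) (auto simp: M_def poly_lagrange_poly)
    ultimately show ?thesis using D0[OF kl] kl fin by (simp add: D_def)
  qed
  \<comment> \<open>Expanding one factor in each basis reduces the claim to the products
    \<open>L k * M l\<close>.\<close>
  have f: "(\<Sum>k\<in>A. smult (poly f (x k)) (L k)) = f"
    unfolding L_def by (rule lagrange_interpolation[OF fin(1) inj(1)]) (use fg fin in simp)
  have g: "(\<Sum>l\<in>A. smult (poly g (y l)) (M l)) = g"
    unfolding M_def by (rule lagrange_interpolation[OF fin(1) inj(2)]) (use fg fin in simp)
  have "f * g = (\<Sum>k\<in>A. \<Sum>l\<in>A. smult (poly f (x k) * poly g (y l)) (L k * M l))"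
    by (subst f[symmetric], subst g[symmetric]) (simp add: sum_product mult_ac)
  then show ?thesis by (simp add: mom_sum mom_smult LM)
qed

section \<open>Bijectivity of the Nesterov mapping and the equivalence with equilibrium\<close>

text \<open>Positive definiteness persists near \<open>c\<close>, and Gauss quadrature provides a
  representing measure for every neighbour.\<close>

lemma posdef_int_moment_cone:
  assumes n: "n \<ge> 1" and pd: "posdef n c" and c: "c \<in> topspace (Euclidean_space (2 * n - 1))"
  shows "c \<in> int_moment_cone n"
proof -
  obtain x \<rho> where x: "inj_on x {1..n}" "\<And>k. k \<in> {1..n} \<Longrightarrow> \<rho> k > 0" "canonical_rep n c x \<rho>"
    using gauss_quadrature[OF pd n] by blast
  obtain e where e: "e > 0" "\<And>c'. (\<forall>i<2*n-1. \<bar>c' i - c i\<bar> < e) \<Longrightarrow> posdef n c'"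
    using posdef_open[OF x(3,1,2)] by blast
  have "c' \<in> moment_cone n"
    if c': "c' \<in> topspace (Euclidean_space (2 * n - 1))" "\<forall>i<2*n-1. \<bar>c' i - c i\<bar> < e" for c'
  proof -
    obtain x' \<rho>' where x': "\<And>k. k \<in> {1..n} \<Longrightarrow> \<rho>' k > 0" "canonical_rep n c' x' \<rho>'"
      using gauss_quadrature[OF e(2)[OF c'(2)] n] by metis
    show ?thesis by (rule canonical_rep_moment_cone[OF x'(2) less_imp_le[OF x'(1)] c'(1)])
  qed
  then show ?thesis
    unfolding int_moment_cone_def interior_of_Euclidean_space_iff using c e(1) by blast
qed

lemma nesterov_inj_on_int_moment_cone:
  assumes n: "n \<ge> 1" and c: "c \<in> int_moment_cone n" and d: "d \<in> int_moment_cone n"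
    and eq: "nesterov n c = nesterov n d"
  shows "c = d"
proof
  fix k
  have top: "c \<in> topspace (Euclidean_space (2 * n - 1))" "d \<in> topspace (Euclidean_space (2 * n - 1))"
    using c d by (auto simp: int_moment_cone_def interior_of_Euclidean_space_iff)
  obtain x \<rho> where x: "inj_on x {1..n}" "\<And>k. k \<in> {1..n} \<Longrightarrow> \<rho> k > 0" "canonical_rep n c x \<rho>"
    using gauss_quadrature[OF int_moment_cone_posdef[OF n c] n] by blast
  obtain y \<tau> where y: "inj_on y {1..n}" "\<And>k. k \<in> {1..n} \<Longrightarrow> \<tau> k > 0" "canonical_rep n d y \<tau>"
    using gauss_quadrature[OF int_moment_cone_posdef[OF n d] n] by blast
  show "c k = d k"
  proof (cases "k < 2 * n - 1")
    case True
    \<comment> \<open>Every index up to \<open>2 * n - 2\<close> is a sum of two indices below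
      \<open>n\<close>, as \<open>nesterov_unique_moments\<close> demands.\<close>
    define i where "i = min k (n - 1)"
    define j where "j = k - i"
    have ij: "i < n" "j < n" "k = i + j" using True n by (auto simp: i_def j_def)
    then have "mom c (monom 1 i * monom 1 j) = mom d (monom 1 i * monom 1 j)"
      by (intro nesterov_unique_moments[OF x(3,1,2) y(3,1,2) eq]) (auto simp: degree_monom_eq)
    then show ?thesis by (simp add: mult_monom mom_monom ij(3))
  next
    case False
    then show ?thesis using top by (simp add: topspace_Euclidean_space)
  qed
qed

text \<open>The weights \<open>1 / poly p (x k)\<close> give a kernel with the values of
  \<open>p\<close> at the nodes; stationarity matches the derivatives too, so the kernel is
  \<open>p\<close>.\<close>

lemma nesterov_preimage_of_stationary:
  assumes n: "n \<ge> 1" and deg: "degree p \<le> 2 * n - 2" and p_pos: "\<And>x. poly p x > 0"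
    and inj: "inj_on x {1..n}"
    and eq: "\<And>k. k \<in> {1..n} \<Longrightarrow>
      2 * (\<Sum>j\<in>{1..n} - {k}. 1 / (x k - x j)) = poly (pderiv p) (x k) / poly p (x k)"
  shows "\<exists>c. c \<in> int_moment_cone n \<and> nesterov n c = Some (coeff p) \<and>
    canonical_rep n c x (\<lambda>k. 1 / poly p (x k))"
proof -
  \<comment> \<open>Truncation after the index \<open>2 * n - 2\<close> makes \<open>c\<close> a
    point of the Euclidean space.\<close>
  define c where "c k = (if k \<le> 2 * n - 2 then (\<Sum>j=1..n. 1 / poly p (x j) * x j ^ k) else 0)" for k
  have rep: "canonical_rep n c x (\<lambda>k. 1 / poly p (x k))"
    unfolding canonical_rep_def by (auto simp: c_def)
  have pos: "1 / poly p (x k) > 0" for k using p_pos by auto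
  have "poly p y \<noteq> 0" for y using p_pos[of y] by simp
  note K = lagrange_kernel_eqI[OF inj n deg this eq]
  have "posdef n c" by (rule posdef_canonical_rep[OF rep inj pos])
  then have "c \<in> int_moment_cone n"
    using n by (intro posdef_int_moment_cone) (auto simp: topspace_Euclidean_space c_def)
  moreover have "nesterov n c = Some (coeff p)"
    using nesterov_canonical_rep[OF rep inj pos] K by simp
  ultimately show ?thesis using rep by blast
qed

lemma nesterov_preimage_of_stationary_inf:
  assumes n: "n \<ge> 2" and deg: "degree p \<le> 2 * n - 2" and p_pos: "\<And>x. poly p x > 0"
    and lc: "coeff p (2 * n - 2) > 0" and inj: "inj_on t {1..n-1}"
    and eq: "\<And>k. k \<in> {1..n-1} \<Longrightarrow>
      2 * (\<Sum>j\<in>{1..n-1} - {k}. 1 / (t k - t j)) = poly (pderiv p) (t k) / poly p (t k)"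
  shows "\<exists>c. c \<in> int_moment_cone n \<and> nesterov n c = Some (coeff p) \<and>
    canonical_rep_inf n c t (\<lambda>k. 1 / poly p (t k)) (1 / coeff p (2 * n - 2))"
proof -
  define c where "c k = (if k \<le> 2 * n - 2 then (\<Sum>j=1..n-1. 1 / poly p (t j) * t j ^ k)
    + (if k = 2 * n - 2 then 1 / coeff p (2 * n - 2) else 0) else 0)" for k
  have rep: "canonical_rep_inf n c t (\<lambda>k. 1 / poly p (t k)) (1 / coeff p (2 * n - 2))"
    unfolding canonical_rep_inf_def using n by (auto simp: c_def)
  have pos: "1 / poly p (t k) > 0" "1 / coeff p (2 * n - 2) > 0" for k using p_pos lc by auto
  have ne: "poly p y \<noteq> 0" for y using p_pos[of y] by simp
  have n1: "n - 1 \<ge> 1" "2 * (n - 1) = 2 * n - 2" using n by auto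
  note K = lagrange_kernel_inf_eqI[OF inj n1(1) _ ne eq, unfolded n1(2), OF deg]
  have "posdef n c" by (rule posdef_canonical_rep_inf[OF rep n inj pos])
  then have "c \<in> int_moment_cone n"
    using n by (intro posdef_int_moment_cone) (auto simp: topspace_Euclidean_space c_def)
  moreover have "nesterov n c = Some (coeff p)"
    using nesterov_canonical_rep_inf[OF rep n inj pos] K by simp
  ultimately show ?thesis using rep by blast
qed

text \<open>For the converse direction: \<open>p\<close> is the kernel of the representation, so its
  values and derivatives at the nodes can be read off.\<close>

lemma canonical_rep_nesterov:
  assumes pd: "posdef n c" and nest: "nesterov n c = Some (coeff p)"
    and rep: "canonical_rep n c x \<rho>" and pos: "\<And>k. k \<in> {1..n} \<Longrightarrow> \<rho> k > 0"
  shows "inj_on x {1..n}"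
    and "k \<in> {1..n} \<Longrightarrow> poly p (x k) = 1 / \<rho> k"
    and "k \<in> {1..n} \<Longrightarrow> poly (pderiv p) (x k) = 2 * (1 / \<rho> k) * (\<Sum>j\<in>{1..n} - {k}. 1 / (x k - x j))"
proof -
  show inj: "inj_on x {1..n}" by (rule posdef_inj_canonical_rep[OF pd rep])
  have p: "p = (\<Sum>k=1..n. smult (1 / \<rho> k) ((lagrange_poly x {1..n} k)\<^sup>2))"
    using nesterov_canonical_rep[OF rep inj pos] nest by (simp add: coeff_inject)
  assume k: "k \<in> {1..n}"
  note K = deriv_lagrange_kernel[OF finite_atLeastAtMost inj k, of "\<lambda>k. 1 / \<rho> k", folded p]
  show "poly p (x k) = 1 / \<rho> k" by (rule K(1))
  show "poly (pderiv p) (x k) = 2 * (1 / \<rho> k) * (\<Sum>j\<in>{1..n} - {k}. 1 / (x k - x j))" by (rule K(2))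
qed

lemma canonical_rep_inf_nesterov:
  assumes pd: "posdef n c" and nest: "nesterov n c = Some (coeff p)" and n: "n \<ge> 2"
    and rep: "canonical_rep_inf n c t \<sigma> l" and pos: "\<And>k. k \<in> {1..n-1} \<Longrightarrow> \<sigma> k > 0" "l > 0"
  shows "inj_on t {1..n-1}" and "coeff p (2 * n - 2) = 1 / l"
    and "k \<in> {1..n-1} \<Longrightarrow> poly p (t k) = 1 / \<sigma> k"
    and "k \<in> {1..n-1} \<Longrightarrow> poly (pderiv p) (t k) = 2 * (1 / \<sigma> k) * (\<Sum>j\<in>{1..n-1} - {k}. 1 / (t k - t j))"
proof -
  show inj: "inj_on t {1..n-1}" by (rule posdef_inj_canonical_rep_inf[OF pd rep n])
  have p: "p = (\<Sum>k=1..n-1. smult (1 / \<sigma> k) ((lagrange_poly t {1..n-1} k)\<^sup>2))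
      + smult (1 / l) ((root_poly t {1..n-1})\<^sup>2)"
    using nesterov_canonical_rep_inf[OF rep n inj pos] nest by (simp add: coeff_inject)
  note K = lagrange_kernel_inf[OF inj, where w = "\<lambda>k. 1 / \<sigma> k" and a = "1 / l", folded p]
  have n1: "n - 1 \<ge> 1" "2 * (n - 1) = 2 * n - 2" using n by auto
  show "coeff p (2 * n - 2) = 1 / l" using K(2)[OF n1(1)] unfolding n1(2) .
  assume k: "k \<in> {1..n-1}"
  show "poly p (t k) = 1 / \<sigma> k" by (rule K(3)[OF k])
  show "poly (pderiv p) (t k) = 2 * (1 / \<sigma> k) * (\<Sum>j\<in>{1..n-1} - {k}. 1 / (t k - t j))"
    by (rule K(4)[OF k])
qed

lemma int_nonneg_cone_pos:
  assumes "n \<ge> 2" "coeff p \<in> int_nonneg_cone n"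
  shows "poly p x > 0"
proof -
  obtain e where e: "e > 0" "poly p x \<ge> e * (1 + x ^ (2 * (n - 1)))"
    using int_nonneg_coneD(3)[OF assms] by (auto simp: right_diff_distrib')
  have "0 \<le> x ^ (2 * (n - 1))" by (simp add: power_mult)
  then have "0 < 1 + x ^ (2 * (n - 1))" by linarith
  with e(1) have "0 < e * (1 + x ^ (2 * (n - 1)))" by (rule mult_pos_pos)
  then show ?thesis using e(2) by linarith
qed

text \<open>Existence uses an equilibrium of \<open>n - 1\<close> points: with \<open>n\<close>
  points numerator and denominator of the ratio would have equal degree in each node, and it need
  not vanish at infinity.\<close>

lemma ex1_nesterov:
  assumes n: "n \<ge> 2" and p: "coeff p \<in> int_nonneg_cone n"
  shows "\<exists>!c. c \<in> int_moment_cone n \<and> nesterov n c = Some (coeff p)"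
proof (rule ex_ex1I)
  obtain e where e: "e > 0" "\<And>x. poly p x \<ge> e * (1 + x ^ (2 * n - 2))"
    using int_nonneg_coneD(3)[OF n p] by blast
  have "2 * n - 2 = 2 * card {1..n-1}" using n by simp
  then obtain t where "inj_on t {1..n-1}" "\<And>k. k \<in> {1..n-1} \<Longrightarrow>
      2 * (\<Sum>j\<in>{1..n-1} - {k}. 1 / (t k - t j)) = poly (pderiv p) (t k) / poly p (t k)"
    using exists_stationary_points[of "{1..n-1}" e p] e by auto
  from nesterov_preimage_of_stationary_inf[OF n _ int_nonneg_cone_pos[OF n p] int_nonneg_coneD(2)[OF n p] this]
  show "\<exists>c. c \<in> int_moment_cone n \<and> nesterov n c = Some (coeff p)"
    using int_nonneg_coneD(1)[OF n p] by auto
next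
  fix c d
  assume "c \<in> int_moment_cone n \<and> nesterov n c = Some (coeff p)"
    and "d \<in> int_moment_cone n \<and> nesterov n d = Some (coeff p)"
  then show "c = d" using nesterov_inj_on_int_moment_cone[of n c d] n by simp
qed

theorem theorem4:
  fixes n :: nat and p :: "real poly" and \<zeta> :: "nat \<Rightarrow> complex"
  assumes "n \<ge> 2"
    and "coeff p \<in> int_nonneg_cone n"
    and "upper_zeros p (n - 1) \<zeta>"
  shows
    "(\<exists>!c. c \<in> int_moment_cone n \<and> nesterov n c = Some (coeff p)) \<and>
     (\<forall>c. c \<in> int_moment_cone n \<and> nesterov n c = Some (coeff p) \<longrightarrow>
        (\<forall>x. equilibrium n (n - 1) \<zeta> x \<longrightarrow>
           (\<forall>k\<in>{1..n}. 1 / poly p (x k) > 0) \<and>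
           canonical_rep n c x (\<lambda>k. 1 / poly p (x k))) \<and>
        (\<forall>t. equilibrium (n - 1) (n - 1) \<zeta> t \<longrightarrow>
           (\<forall>k\<in>{1..n-1}. 1 / poly p (t k) > 0) \<and> 1 / coeff p (2 * n - 2) > 0 \<and>
           canonical_rep_inf n c t (\<lambda>k. 1 / poly p (t k)) (1 / coeff p (2 * n - 2))) \<and>
        (\<forall>x \<rho>. (\<forall>k\<in>{1..n}. \<rho> k > 0) \<and> canonical_rep n c x \<rho> \<longrightarrow>
           equilibrium n (n - 1) \<zeta> x \<and>
           (\<forall>k\<in>{1..n}. \<rho> k = 1 / poly p (x k))) \<and>
        (\<forall>t \<sigma> l. (\<forall>k\<in>{1..n-1}. \<sigma> k > 0) \<and> l > 0 \<and> canonical_rep_inf n c t \<sigma> l \<longrightarrow>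
           equilibrium (n - 1) (n - 1) \<zeta> t \<and>
           (\<forall>k\<in>{1..n-1}. \<sigma> k = 1 / poly p (t k)) \<and> l = 1 / coeff p (2 * n - 2)))"
proof -
  note ex1 = ex1_nesterov[OF assms(1,2)]
  note p_pos = int_nonneg_cone_pos[OF assms(1,2)]
  note deg = int_nonneg_coneD(1)[OF assms(1,2), THEN eq_imp_le]
  note lc = int_nonneg_coneD(2)[OF assms(1,2)]
  have n1: "n \<ge> 1" using assms(1) by simp
  have "poly p x \<noteq> 0" for x using p_pos[of x] by simp
  note equi = equilibrium_iff[OF assms(3) this]
  have weights_pos: "1 / poly p x > 0" "1 / coeff p (2 * n - 2) > 0" for x
    using p_pos lc by auto
  show ?thesis (is "?E \<and> (\<forall>c. ?P c \<longrightarrow> ?Q c)")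
  proof (rule conjI[OF ex1 allI[OF impI]])
    fix c assume c: "?P c"
    have pd: "posdef n c" using int_moment_cone_posdef[OF n1] c by blast
    \<comment> \<open>The equilibrium yields some moment vector with image \<open>p\<close> and this
      representation; uniqueness identifies it with \<open>c\<close>.\<close>
    have "canonical_rep n c x (\<lambda>k. 1 / poly p (x k))" if "equilibrium n (n - 1) \<zeta> x" for x
      using nesterov_preimage_of_stationary[OF n1 deg p_pos, of x] that ex1 c unfolding equi by blast
    moreover have "canonical_rep_inf n c t (\<lambda>k. 1 / poly p (t k)) (1 / coeff p (2 * n - 2))"
      if "equilibrium (n - 1) (n - 1) \<zeta> t" for t
      using nesterov_preimage_of_stationary_inf[OF assms(1) deg p_pos lc, of t] that ex1 c
      unfolding equi by blast
    \<comment> \<open>Values of the kernel at the nodes give the weights, and dividing its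
      derivatives by them gives the force balance.\<close>
    moreover have "equilibrium n (n - 1) \<zeta> x \<and> (\<forall>k\<in>{1..n}. \<rho> k = 1 / poly p (x k))"
      if "\<forall>k\<in>{1..n}. \<rho> k > 0" "canonical_rep n c x \<rho>" for x \<rho>
      using canonical_rep_nesterov[OF pd _ that(2)] c that(1) unfolding equi by auto
    moreover have "equilibrium (n - 1) (n - 1) \<zeta> t \<and>
        (\<forall>k\<in>{1..n-1}. \<sigma> k = 1 / poly p (t k)) \<and> l = 1 / coeff p (2 * n - 2)"
      if "\<forall>k\<in>{1..n-1}. \<sigma> k > 0" "l > 0" "canonical_rep_inf n c t \<sigma> l" for t \<sigma> l
      using canonical_rep_inf_nesterov[OF pd _ assms(1) that(3) _ that(2)] c that(1) unfolding equi by auto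
    ultimately show "?Q c"
      using weights_pos by (intro conjI allI impI ballI) blast+
  qed
qed

end
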